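(* Let $\mathcal{M}$ be one of the (Kerr) Malament-Hogarth spacetimes described in the context, with an observer $\mathcal{O}_r$ on a curve $\gamma_1$ of infinite proper time who signals to an observer on a curve $\gamma_2$ of finite proper time. For $b\in\mathbb{N}\cup\{\infty\}$ let $\mathcal{C}_b$ be the class of relations $R\subseteq\mathbb{N}$ computable in this arrangement when the number of signals sent to the observer on $\gamma_2$ is, for each input, finite and at most $b$ (for $b=\infty$: finite, with no fixed bound). Then $\mathcal{C}_b$ is a subclass of the class of $\Delta_2$ relations on $\mathbb{N}$, and it is a proper subclass of the $\Delta_2$ relations if and only if $b<\infty$, i.e. if and only if there is a fixed finite bound on the number of signals sent to the observer on the finite length path.
   Context: **The spacetime arrangement.** In the spacetimes considered (Kerr spacetimes with rotating black holes, which are Malament-Hogarth) there are a future-endless timelike half-curve $\gamma_1$ of infinite proper time, a point $p$ with $\gamma_1\subset I^-(p)$ (the chronological past of $p$), and a future-directed timelike curve $\gamma_2$ of finite proper time ending at $p$. An observer $\mathcal{O}_r$ moves along $\gamma_1$ with a Turing machine, which can run for an unbounded number of steps, and can send signals that are received by the observer on $\gamma_2$ before or at $p$. Only one such pair $(\gamma_1,\gamma_2)$ is used, and it is required that only finitely many signals are ever sent. **Computability in this arrangement.** Fix $b\in\mathbb{N}\cup\{\infty\}$. A relation $R\subseteq\mathbb{N}$ is in $\mathcal{C}_b$ if there are a finite alphabet $A$ of signal types, a Turing machine $P$, and a recursive function $D:\mathbb{N}\times A^{<\mathbb{N}}\to\{0,1\}$ such that, for every input $n$, $P$ run forever on $n$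 emits a finite sequence of signals $s_n\in A^{<\mathbb{N}}$ of length at most $b$ (no restriction other than finiteness if $b=\infty$), and $n\in R\iff D(n,s_n)=1$. Here $b$ is fixed independently of $n$. **Arithmetical hierarchy.** $\Sigma_0=\Pi_0$ are the recursive predicates; $\Sigma_{n+1}$ consists of the predicates $\{\vec a:\exists b\,(b,\vec a)\in P\}$ with $P\in\Pi_n$; $\Pi_n$ consists of complements of $\Sigma_n$ predicates; $\Delta_2=\Sigma_2\cap\Pi_2$. *)

theory Defs
  imports "HOL-Analysis.Analysis" "HOL-Library.Extended_Nat" "HOL-Library.Nat_Bijection"
begin

text \<open>
  Total recursive functions of arity \<open>k\<close>, represented as functions on lists whose values
  matter only on lists of length \<open>k\<close>.  Minimisation is applied to regular functions only,
  so that all functions are total.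
\<close>

inductive recursive :: "nat \<Rightarrow> (nat list \<Rightarrow> nat) \<Rightarrow> bool" where
  zero: "recursive k (\<lambda>xs. 0)"
| succ: "recursive 1 (\<lambda>xs. Suc (xs ! 0))"
| proj: "i < k \<Longrightarrow> recursive k (\<lambda>xs. xs ! i)"
| comp: "recursive (length fs) g \<Longrightarrow> (\<And>f. f \<in> set fs \<Longrightarrow> recursive k f)
    \<Longrightarrow> recursive k (\<lambda>xs. g (map (\<lambda>f. f xs) fs))"
| prec: "recursive k f \<Longrightarrow> recursive (Suc (Suc k)) g
    \<Longrightarrow> recursive (Suc k) (\<lambda>xs. rec_nat (f (tl xs)) (\<lambda>i r. g (i # r # tl xs)) (hd xs))"
| mini: "recursive (Suc k) f \<Longrightarrow> (\<And>xs. length xs = k \<Longrightarrow> \<exists>y. f (y # xs) = 0)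
    \<Longrightarrow> recursive k (\<lambda>xs. LEAST y. f (y # xs) = 0)"

definition tuples :: "nat \<Rightarrow> nat list set" where
  "tuples k = {xs. length xs = k}"

definition recursive_rels :: "nat \<Rightarrow> nat list set set" where
  "recursive_rels k = {S. S \<subseteq> tuples k \<and>
     (\<exists>f. recursive k f \<and> (\<forall>xs\<in>tuples k. f xs = (if xs \<in> S then 1 else 0)))}"

fun Sigma_rels :: "nat \<Rightarrow> nat \<Rightarrow> nat list set set"
  and Pi_rels :: "nat \<Rightarrow> nat \<Rightarrow> nat list set set" where
  "Sigma_rels 0 k = recursive_rels k"
| "Sigma_rels (Suc n) k = {{as \<in> tuples k. \<exists>b. b # as \<in> P} |P. P \<in> Pi_rels n (Suc k)}"
| "Pi_rels 0 k = recursive_rels k"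
| "Pi_rels (Suc n) k =
     {tuples k - {as \<in> tuples k. \<exists>b. b # as \<in> P} |P. P \<in> Pi_rels n (Suc k)}"

lemma Pi_rels_Suc: "Pi_rels (Suc n) k = {tuples k - S |S. S \<in> Sigma_rels (Suc n) k}"
  by auto

definition Delta_rels :: "nat \<Rightarrow> nat \<Rightarrow> nat list set set" where
  "Delta_rels n k = Sigma_rels n k \<inter> Pi_rels n k"

definition Delta2 :: "nat set set" where
  "Delta2 = {R. (\<lambda>n. [n]) ` R \<in> Delta_rels 2 1}"

text \<open>
  Single-tape machines with states \<open>{..<states P}\<close>, tape alphabet \<open>{..<symbols P}\<close> (the symbol 0
  is the blank) and signal alphabet \<open>{..<signals P}\<close>.  A transition may emit one signal;
  the value \<open>None\<close> of \<open>delta\<close> means that the machine halts.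
\<close>

datatype move = MLeft | MStay | MRight

record tm =
  states :: nat
  symbols :: nat
  signals :: nat
  delta :: "nat \<Rightarrow> nat \<Rightarrow> (nat \<times> nat \<times> move \<times> nat option) option"

definition wf_tm :: "tm \<Rightarrow> bool" where
  "wf_tm P \<longleftrightarrow> 0 < states P \<and> 2 \<le> symbols P \<and>
     (\<forall>q<states P. \<forall>a<symbols P. \<forall>q' a' d e. delta P q a = Some (q', a', d, e) \<longrightarrow>
        q' < states P \<and> a' < symbols P \<and> (\<forall>x. e = Some x \<longrightarrow> x < signals P))"

fun move_head :: "move \<Rightarrow> int \<Rightarrow> int" where
  "move_head MLeft i = i - 1"
| "move_head MStay i = i"
| "move_head MRight i = i + 1"

type_synonym config = "nat \<times> int \<times> (int \<Rightarrow> nat)"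

text \<open>Inputs are written in unary; the machine starts in state 0 on the leftmost input cell.\<close>

definition init_config :: "nat \<Rightarrow> config" where
  "init_config n = (0, 0, \<lambda>i. if 0 \<le> i \<and> i < int n then 1 else 0)"

fun step :: "tm \<Rightarrow> config \<Rightarrow> config" where
  "step P (q, i, tape) = (case delta P q (tape i) of
      None \<Rightarrow> (q, i, tape)
    | Some (q', a', d, e) \<Rightarrow> (q', move_head d i, tape(i := a')))"

fun emission :: "tm \<Rightarrow> config \<Rightarrow> nat option" where
  "emission P (q, i, tape) = (case delta P q (tape i) of
      None \<Rightarrow> None
    | Some (q', a', d, e) \<Rightarrow> e)"

definition emitted_at :: "tm \<Rightarrow> nat \<Rightarrow> nat \<Rightarrow> nat option" where
  "emitted_at P n t = emission P ((step P ^^ t) (init_config n))"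

definition emission_times :: "tm \<Rightarrow> nat \<Rightarrow> nat set" where
  "emission_times P n = {t. emitted_at P n t \<noteq> None}"

text \<open>Meaningful only if \<open>emission_times P n\<close> is finite.\<close>

definition emitted :: "tm \<Rightarrow> nat \<Rightarrow> nat list" where
  "emitted P n = map (\<lambda>t. the (emitted_at P n t)) (sorted_list_of_set (emission_times P n))"

text \<open>
  Recursive functions from pairs of a number and a word over \<open>{..<k}\<close> to \<open>{0, 1}\<close>; words are
  coded by the recursive bijection \<open>list_encode\<close>.
\<close>

definition recursive_decision :: "nat \<Rightarrow> (nat \<Rightarrow> nat list \<Rightarrow> nat) \<Rightarrow> bool" where
  "recursive_decision k D \<longleftrightarrow>
     (\<forall>n. \<forall>s\<in>lists {..<k}. D n s \<in> {0, 1}) \<and>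
     (\<exists>f. recursive 2 f \<and> (\<forall>n. \<forall>s\<in>lists {..<k}. f [n, list_encode s] = D n s))"

text \<open>
  A spacetime enters only through its future-directed timelike curves: \<open>timelike c a b\<close> says that
  \<open>a < b\<close> and \<open>c\<close> restricted to \<open>{a..b}\<close> is such a curve, parametrised by proper time.
  The assumptions hold in every time-oriented Lorentzian manifold, in particular in Kerr spacetimes.
\<close>

type_synonym 'e timelike_curves = "(real \<Rightarrow> 'e) \<Rightarrow> real \<Rightarrow> real \<Rightarrow> bool"

definition chron :: "'e timelike_curves \<Rightarrow> 'e \<Rightarrow> 'e \<Rightarrow> bool" where
  "chron timelike x y \<longleftrightarrow> (\<exists>c a b. timelike c a b \<and> c a = x \<and> c b = y)"

definition chron_past :: "'e timelike_curves \<Rightarrow> 'e \<Rightarrow> 'e set" where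
  "chron_past timelike p = {x. chron timelike x p}"

definition chron_future :: "'e timelike_curves \<Rightarrow> 'e \<Rightarrow> 'e set" where
  "chron_future timelike p = {x. chron timelike p x}"

locale spacetime =
  fixes timelike :: "('e :: t2_space) timelike_curves"
  assumes timelike_less: "timelike c a b \<Longrightarrow> a < b"
    and timelike_continuous: "timelike c a b \<Longrightarrow> continuous_on {a..b} c"
    and timelike_cong: "timelike c a b \<Longrightarrow> (\<And>s. s \<in> {a..b} \<Longrightarrow> c s = c' s) \<Longrightarrow> timelike c' a b"
    and timelike_restrict: "timelike c a b \<Longrightarrow> a \<le> a' \<Longrightarrow> a' < b' \<Longrightarrow> b' \<le> b \<Longrightarrow> timelike c a' b'"
    and timelike_shift: "timelike c a b \<Longrightarrow> timelike (\<lambda>s. c (s + d)) (a - d) (b - d)"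
    and chron_trans: "chron timelike x y \<Longrightarrow> chron timelike y z \<Longrightarrow> chron timelike x z"
    and open_chron_past: "open (chron_past timelike p)"
    and open_chron_future: "open (chron_future timelike p)"

text \<open>
  The half-curve \<open>\<gamma>1\<close> is defined on \<open>{0..}\<close>, hence has infinite proper time, and is future-endless;
  \<open>\<gamma>2\<close> has proper time \<open>T\<close> and ends at \<open>p\<close>.
\<close>

locale malament_hogarth = spacetime timelike
  for timelike :: "('e :: t2_space) timelike_curves" +
  fixes \<gamma>1 \<gamma>2 :: "real \<Rightarrow> 'e" and T :: real and p :: 'e
  assumes \<gamma>1_timelike: "\<And>s. s > 0 \<Longrightarrow> timelike \<gamma>1 0 s"
    and \<gamma>1_endless: "\<nexists>x. (\<gamma>1 \<longlongrightarrow> x) at_top"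
    and \<gamma>1_past: "\<gamma>1 ` {0..} \<subseteq> chron_past timelike p"
    and \<gamma>2_timelike: "timelike \<gamma>2 0 T"
    and \<gamma>2_end: "\<gamma>2 T = p"

text \<open>
  The machine performs its step number \<open>t\<close> at proper time \<open>t\<close> along \<open>\<gamma>1\<close>.  A signal sent from
  an event can be received on \<open>\<gamma>2\<close>, before or at its endpoint, if that event chronologically
  precedes some event of \<open>\<gamma>2\<close>.
\<close>

definition receivable :: "'e timelike_curves \<Rightarrow> (real \<Rightarrow> 'e) \<Rightarrow> real \<Rightarrow> 'e \<Rightarrow> bool" where
  "receivable timelike \<gamma>2 T x \<longleftrightarrow> (\<exists>u\<in>{0..T}. chron timelike x (\<gamma>2 u))"

definition signal_class ::
  "'e timelike_curves \<Rightarrow> (real \<Rightarrow> 'e) \<Rightarrow> (real \<Rightarrow> 'e) \<Rightarrow> real \<Rightarrow> enat \<Rightarrow> nat set set" where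
  "signal_class timelike \<gamma>1 \<gamma>2 T b =
     {R. \<exists>P D. wf_tm P \<and> recursive_decision (signals P) D \<and>
        (\<forall>n. finite (emission_times P n) \<and>
             (\<forall>t\<in>emission_times P n. receivable timelike \<gamma>2 T (\<gamma>1 (real t))) \<and>
             enat (length (emitted P n)) \<le> b \<and>
             (n \<in> R \<longleftrightarrow> D n (emitted P n) = 1))}"

end

theory Submission
  imports Defs
begin

text \<open>
  Every event of \<open>\<gamma>1\<close> precedes \<open>p\<close>, so all signals can be received and only computability matters.
  A set decided from finitely many signals is limit computable: decode the word emitted so far. The
  approximation changes at most as often as signals are sent. Conversely, a set with a recursive
  approximation \<open>h\<close> is decided by the parity of the number of signals of a machine that signals
  whenever \<open>h\<close> changes. Limit computable sets are the \<open>\<Delta>\<^sub>2\<close> sets, which settles \<open>b = \<infinity>\<close> and the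
  inclusion. For finite \<open>b\<close>, the set of all \<open>e\<close> such that machine \<open>e\<close> on input \<open>e\<close> sends an even number
  of signals, counted up to \<open>b + 1\<close>, is \<open>\<Delta>\<^sub>2\<close> but diagonalises against these parity machines.
\<close>

section \<open>Recursive functions\<close>

text \<open>Membership in a signal class involves a machine, a signal alphabet and a decision
  function at once. Passing to a 0-1 valued approximation and back to a parity machine leaves only a
  machine with a single signal type, so the diagonal set has to defeat machines alone and needs no
  enumeration of decision functions. The price is at most one additional signal, since the
  approximation may start at 1; this is where \<open>b + 1\<close> comes from. Most of the work is
  the bridge between the two models of computation, and both directions occur. Recursive functions
  become Turing machines that run forever and signal on the way; this goes through counter programs,
  and as a compiled machine does not keep time with its source, only numbers of signals are
  transferred. Conversely, Turing machines are simulated by recursive functions, uniformly in a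
  code. The diagonal set consults this simulation at every number, also at those that code no
  machine, so the simulation has to be total.\<close>

text \<open>\<open>recursive\<close> also depends on the junk values on lists of the wrong length; \<open>computable\<close> does not.\<close>

definition computable :: "nat \<Rightarrow> (nat list \<Rightarrow> nat) \<Rightarrow> bool" where
  "computable k f \<longleftrightarrow> (\<exists>g. recursive k g \<and> (\<forall>xs. length xs = k \<longrightarrow> g xs = f xs))"

lemma computable_cong:
  assumes "computable k f" "\<And>xs. length xs = k \<Longrightarrow> f xs = g xs"
  shows "computable k g"
  using assms unfolding computable_def by metis

lemma computable_recursive: "recursive k f \<Longrightarrow> computable k f"
  unfolding computable_def by blast

lemma computable_comp:
  assumes "computable (length fs) g" "\<And>f. f \<in> set fs \<Longrightarrow> computable k f"
  shows "computable k (\<lambda>xs. g (map (\<lambda>f. f xs) fs))"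
proof -
  obtain g' where g': "recursive (length fs) g'" "\<And>xs. length xs = length fs \<Longrightarrow> g' xs = g xs"
    using assms(1) unfolding computable_def by blast
  obtain F where F: "\<And>f. f \<in> set fs \<Longrightarrow> recursive k (F f) \<and> (\<forall>xs. length xs = k \<longrightarrow> F f xs = f xs)"
    using assms(2) unfolding computable_def by metis
  have "recursive k (\<lambda>xs. g' (map (\<lambda>f. f xs) (map F fs)))"
    by (rule recursive.comp) (use g' F in auto)
  then have "computable k (\<lambda>xs. g' (map (\<lambda>f. f xs) (map F fs)))"
    by (rule computable_recursive)
  then show ?thesis
  proof (rule computable_cong)
    fix xs :: "nat list" assume "length xs = k"
    then have "map (\<lambda>f. f xs) (map F fs) = map (\<lambda>f. f xs) fs"
      using F by auto
    then show "g' (map (\<lambda>f. f xs) (map F fs)) = g (map (\<lambda>f. f xs) fs)"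
      using g'(2)[of "map (\<lambda>f. f xs) fs"] by (simp only: length_map)
  qed
qed

lemma computable_comp1:
  assumes "computable 1 (\<lambda>xs. F (xs ! 0))" "computable k A"
  shows "computable k (\<lambda>xs. F (A xs))"
  using computable_comp[of "[A]" "\<lambda>xs. F (xs ! 0)" k] assms by simp

lemma computable_comp2:
  assumes "computable 2 (\<lambda>xs. F (xs ! 0) (xs ! 1))" "computable k A" "computable k B"
  shows "computable k (\<lambda>xs. F (A xs) (B xs))"
proof -
  have "computable k (\<lambda>xs. (\<lambda>xs. F (xs ! 0) (xs ! 1)) (map (\<lambda>f. f xs) [A, B]))"
    by (rule computable_comp) (use assms in \<open>auto simp: numeral_2_eq_2\<close>)
  then show ?thesis by simp
qed

lemma computable_comp3:
  assumes "computable 3 (\<lambda>xs. F (xs ! 0) (xs ! 1) (xs ! 2))"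
    "computable k A" "computable k B" "computable k C"
  shows "computable k (\<lambda>xs. F (A xs) (B xs) (C xs))"
proof -
  have "computable k (\<lambda>xs. (\<lambda>xs. F (xs ! 0) (xs ! 1) (xs ! 2)) (map (\<lambda>f. f xs) [A, B, C]))"
    by (rule computable_comp) (use assms in \<open>auto simp: numeral_3_eq_3\<close>)
  then show ?thesis by simp
qed

lemma computable_proj: "i < k \<Longrightarrow> computable k (\<lambda>xs. xs ! i)"
  by (intro computable_recursive recursive.proj)

lemma computable_Suc:
  assumes "computable k A"
  shows "computable k (\<lambda>xs. Suc (A xs))"
  by (rule computable_comp1[OF computable_recursive[OF recursive.succ] assms])

lemma computable_const: "computable k (\<lambda>xs. c)"
  by (induction c) (auto intro: computable_recursive recursive.zero computable_Suc)

text \<open>Under a recursion or a minimisation the original arguments appear as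
  \<open>drop 2 ys\<close> or \<open>drop 1 ys\<close>; reading one of them is still a
  projection.\<close>

lemma computable_drop_nth: "j + i < k \<Longrightarrow> computable k (\<lambda>xs. drop j xs ! i)"
  by (rule computable_cong[OF computable_proj[of "j + i"]]) auto

text \<open>The scheme \<open>recursive.prec\<close> recurses on the head of the argument list and
  keeps the tail as parameters. Putting \<open>A xs\<close> in front of \<open>xs\<close> allows any
  computable number of rounds while the step still sees all of \<open>xs\<close>.\<close>

lemma computable_rec_nat:
  assumes "computable k A" "computable k B"
    and "computable (k + 2) (\<lambda>ys. G (ys ! 0) (ys ! 1) (drop 2 ys))"
  shows "computable k (\<lambda>xs. rec_nat (B xs) (\<lambda>i r. G i r xs) (A xs))"
proof -
  obtain B' where B': "recursive k B'" "\<And>xs. length xs = k \<Longrightarrow> B' xs = B xs"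
    using assms(2) unfolding computable_def by blast
  obtain G' where G': "recursive (Suc (Suc k)) G'"
    "\<And>ys. length ys = k + 2 \<Longrightarrow> G' ys = G (ys ! 0) (ys ! 1) (drop 2 ys)"
    using assms(3) unfolding computable_def by auto
  let ?h = "\<lambda>xs. rec_nat (B' (tl xs)) (\<lambda>i r. G' (i # r # tl xs)) (hd xs)"
  let ?fs = "A # map (\<lambda>i xs. xs ! i) [0..<k]"
  have "computable (length ?fs) ?h"
    using recursive.prec[OF B'(1) G'(1)] computable_recursive by simp
  then have "computable k (\<lambda>xs. ?h (map (\<lambda>f. f xs) ?fs))"
    by (rule computable_comp) (use assms(1) in \<open>auto intro: computable_proj\<close>)
  then show ?thesis
  proof (rule computable_cong)
    fix xs :: "nat list" assume xs: "length xs = k"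
    then have eq: "map (\<lambda>f. f xs) (map (\<lambda>i xs. xs ! i) [0..<k]) = xs"
      by (auto intro: nth_equalityI)
    have "rec_nat (B' xs) (\<lambda>i r. G' (i # r # xs)) n = rec_nat (B xs) (\<lambda>i r. G i r xs) n" for n
      by (induction n) (use B' G' xs in auto)
    then show "?h (map (\<lambda>f. f xs) ?fs) = rec_nat (B xs) (\<lambda>i r. G i r xs) (A xs)"
      using eq by simp
  qed
qed

lemma computable_Least:
  assumes "computable (Suc k) (\<lambda>ys. F (ys ! 0) (drop 1 ys))"
    and "\<And>xs. length xs = k \<Longrightarrow> \<exists>y. F y xs = 0"
  shows "computable k (\<lambda>xs. LEAST y. F y xs = 0)"
proof -
  obtain F' where F': "recursive (Suc k) F'"
    "\<And>ys. length ys = Suc k \<Longrightarrow> F' ys = F (ys ! 0) (drop 1 ys)"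
    using assms(1) unfolding computable_def by blast
  have "recursive k (\<lambda>xs. LEAST y. F' (y # xs) = 0)"
    by (rule recursive.mini[OF F'(1)]) (use F' assms(2) in auto)
  then show ?thesis
    by (rule computable_cong[OF computable_recursive]) (use F' in simp)
qed

lemmas computable_nth = computable_proj computable_drop_nth


section \<open>Arithmetic, case distinctions and finite sums\<close>

lemma computable_add:
  assumes "computable k A" "computable k B"
  shows "computable k (\<lambda>xs. A xs + B xs)"
proof -
  have *: "rec_nat b (\<lambda>i r. Suc r) a = a + b" for a b :: nat
    by (induction a) auto
  have "computable 2 (\<lambda>xs. rec_nat (xs ! 1) (\<lambda>i r. Suc r) (xs ! 0))"
    by (intro computable_rec_nat computable_Suc computable_nth) auto
  then show ?thesis
    using computable_comp2[of "(+)", OF _ assms] by (simp add: *)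
qed

lemma computable_pred:
  assumes "computable k A"
  shows "computable k (\<lambda>xs. A xs - 1)"
proof -
  have *: "rec_nat 0 (\<lambda>i r. i) a = a - 1" for a :: nat
    by (cases a) auto
  have "computable 1 (\<lambda>xs. rec_nat 0 (\<lambda>i r. i) (xs ! 0))"
    by (intro computable_rec_nat computable_const computable_nth) auto
  then show ?thesis
    using computable_comp1[of "\<lambda>a. a - 1", OF _ assms] by (simp only: *)
qed

lemma computable_diff:
  assumes "computable k A" "computable k B"
  shows "computable k (\<lambda>xs. A xs - B xs)"
proof -
  have *: "rec_nat b (\<lambda>i r. r - 1) a = b - a" for a b :: nat
    by (induction a) auto
  have "computable 2 (\<lambda>xs. rec_nat (xs ! 0) (\<lambda>i r. r - 1) (xs ! 1))"
    by (intro computable_rec_nat computable_pred computable_nth) auto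
  then show ?thesis
    using computable_comp2[of "(-)", OF _ assms] by (simp only: *)
qed

lemma computable_if_zero:
  assumes "computable k C" "computable k A" "computable k B"
  shows "computable k (\<lambda>xs. if C xs = 0 then A xs else B xs)"
proof -
  have *: "rec_nat a (\<lambda>i r. b) c = (if c = 0 then a else b)" for a b c :: nat
    by (cases c) auto
  have "computable 3 (\<lambda>xs. rec_nat (xs ! 1) (\<lambda>i r. xs ! 2) (xs ! 0))"
    by (intro computable_rec_nat computable_nth) auto
  then show ?thesis
    using computable_comp3[of "\<lambda>c a b. if c = 0 then a else b", OF _ assms] by (simp only: *)
qed

lemma computable_if_le:
  assumes "computable k C" "computable k D" "computable k A" "computable k B"
  shows "computable k (\<lambda>xs. if C xs \<le> D xs then A xs else B xs)"
  using computable_if_zero[OF computable_diff[OF assms(1,2)] assms(3,4)] by simp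

lemma computable_if_less:
  assumes "computable k C" "computable k D" "computable k A" "computable k B"
  shows "computable k (\<lambda>xs. if C xs < D xs then A xs else B xs)"
  using computable_if_le[OF computable_Suc[OF assms(1)] assms(2-4)] by (simp add: Suc_le_eq)

lemma computable_if_eq:
  assumes "computable k C" "computable k D" "computable k A" "computable k B"
  shows "computable k (\<lambda>xs. if C xs = D xs then A xs else B xs)"
  by (rule computable_cong[OF computable_if_le[OF assms(1,2)
        computable_if_le[OF assms(2,1,3,4)] assms(4)]]) auto

lemma computable_sum:
  assumes "computable k A"
    and "computable (Suc k) (\<lambda>ys. F (ys ! 0) (drop 1 ys))"
  shows "computable k (\<lambda>xs. \<Sum>i<A xs. F i xs)"
proof -
  have *: "rec_nat 0 (\<lambda>i r. r + F i xs) a = (\<Sum>i<a. F i xs)" for a xs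
    by (induction a) auto
  \<comment> \<open>In the recursion step the list is the index, the accumulator and then the
    parameters. \<open>?fs\<close> skips the accumulator at position 1, so that \<open>F\<close>
    finds the index directly followed by the parameters.\<close>
  let ?fs = "(\<lambda>ys. ys ! 0) # map (\<lambda>i ys. ys ! (i + 2)) [0..<k]"
  have "computable (k + 2) (\<lambda>ys. (\<lambda>ys. F (ys ! 0) (drop 1 ys)) (map (\<lambda>f. f ys) ?fs))"
    by (rule computable_comp) (use assms(2) in \<open>auto intro!: computable_nth\<close>)
  then have "computable (k + 2) (\<lambda>ys. F (ys ! 0) (drop 2 ys))"
  proof (rule computable_cong)
    fix ys :: "nat list" assume "length ys = k + 2"
    then have "map ((\<lambda>f. f ys) \<circ> (\<lambda>i ys. ys ! (i + 2))) [0..<k] = drop 2 ys"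
      by (auto intro!: nth_equalityI simp: add.commute)
    then show "F (map (\<lambda>f. f ys) ?fs ! 0) (drop 1 (map (\<lambda>f. f ys) ?fs)) = F (ys ! 0) (drop 2 ys)"
      by simp
  qed
  then have "computable k (\<lambda>xs. rec_nat 0 (\<lambda>i r. r + F i xs) (A xs))"
    by (intro computable_rec_nat computable_const computable_add computable_nth assms) auto
  then show ?thesis
    by (simp only: *)
qed

section \<open>The Cantor pairing function and its inverses\<close>

lemma computable_triangle:
  assumes "computable k A"
  shows "computable k (\<lambda>xs. triangle (A xs))"
proof -
  have *: "rec_nat 0 (\<lambda>i r. r + Suc i) a = triangle a" for a
    by (induction a) auto
  have "computable 1 (\<lambda>xs. rec_nat 0 (\<lambda>i r. r + Suc i) (xs ! 0))"
    by (intro computable_rec_nat computable_const computable_add computable_Suc computable_nth) auto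
  then show ?thesis
    using computable_comp1[of triangle, OF _ assms] by (simp only: *)
qed

lemma computable_prod_encode:
  assumes "computable k A" "computable k B"
  shows "computable k (\<lambda>xs. prod_encode (A xs, B xs))"
  unfolding prod_encode_def split
  by (intro computable_add computable_triangle assms)

lemma triangle_mono: "m \<le> n \<Longrightarrow> triangle m \<le> triangle n"
  by (induction n) (auto simp: le_Suc_eq)

text \<open>The code of \<open>(m, n)\<close> is \<open>triangle (m + n) + m\<close>, so its
  diagonal \<open>m + n\<close> is the least \<open>s\<close> with
  \<open>c < triangle (Suc s)\<close>. The inequality is written as a truncated difference equal to
  0 because this is what minimisation tests.\<close>

lemma sum_prod_decode:
  "fst (prod_decode c) + snd (prod_decode c) = (LEAST s. Suc c - triangle (Suc s) = 0)"
proof -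
  obtain m n where mn: "prod_decode c = (m, n)" by force
  then have c: "c = triangle (m + n) + m"
    using prod_decode_inverse[of c] by (simp add: prod_encode_def)
  have "(LEAST s. Suc c - triangle (Suc s) = 0) = m + n"
  proof (rule Least_equality)
    show "Suc c - triangle (Suc (m + n)) = 0"
      using c by simp
    fix s assume s: "Suc c - triangle (Suc s) = 0"
    show "m + n \<le> s"
    proof (rule ccontr)
      assume "\<not> m + n \<le> s"
      then have "triangle (Suc s) \<le> triangle (m + n)" by (intro triangle_mono) auto
      with s c show False by simp
    qed
  qed
  with mn show ?thesis by simp
qed

lemma fst_prod_decode:
  "fst (prod_decode c) = c - triangle (LEAST s. Suc c - triangle (Suc s) = 0)"
proof -
  have "c = triangle (fst (prod_decode c) + snd (prod_decode c)) + fst (prod_decode c)"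
    using prod_decode_inverse[of c] by (simp add: prod_encode_def split_beta)
  then show ?thesis unfolding sum_prod_decode by linarith
qed

lemma computable_prod_decode_sum:
  assumes "computable k A"
  shows "computable k (\<lambda>xs. LEAST s. Suc (A xs) - triangle (Suc s) = 0)"
proof -
  have le_triangle: "c \<le> triangle c" for c
    by (induction c) auto
  have "computable 1 (\<lambda>xs. LEAST s. Suc (xs ! 0) - triangle (Suc s) = 0)"
  proof (rule computable_Least)
    show "computable (Suc 1) (\<lambda>ys. Suc (drop 1 ys ! 0) - triangle (Suc (ys ! 0)))"
      by (intro computable_diff computable_triangle computable_Suc computable_nth) auto
    show "\<exists>s. Suc (xs ! 0) - triangle (Suc s) = 0" for xs :: "nat list"
      using le_triangle[of "Suc (xs ! 0)"] by (metis diff_is_0_eq)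
  qed
  then show ?thesis by (rule computable_comp1) (rule assms)
qed

lemma computable_fst_prod_decode:
  assumes "computable k A"
  shows "computable k (\<lambda>xs. fst (prod_decode (A xs)))"
  unfolding fst_prod_decode
  by (intro computable_diff computable_triangle computable_prod_decode_sum assms)

lemma computable_snd_prod_decode:
  assumes "computable k A"
  shows "computable k (\<lambda>xs. snd (prod_decode (A xs)))"
proof -
  have *: "snd (prod_decode c) = (LEAST s. Suc c - triangle (Suc s) = 0) - fst (prod_decode c)" for c
    unfolding sum_prod_decode[symmetric] by simp
  show ?thesis
    unfolding * by (intro computable_diff computable_prod_decode_sum computable_fst_prod_decode assms)
qed

text \<open>Head and tail of a list coded by \<open>list_encode\<close>; the empty list, coded by 0, behaves like an
  infinite list of zeros.\<close>

definition code_hd :: "nat \<Rightarrow> nat" where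
  "code_hd c = fst (prod_decode (c - 1))"

definition code_tl :: "nat \<Rightarrow> nat" where
  "code_tl c = snd (prod_decode (c - 1))"

definition code_Cons :: "nat \<Rightarrow> nat \<Rightarrow> nat" where
  "code_Cons a c = Suc (prod_encode (a, c))"

definition code_nth :: "nat \<Rightarrow> nat \<Rightarrow> nat" where
  "code_nth c i = code_hd ((code_tl ^^ i) c)"

lemma code_hd_Cons [simp]: "code_hd (code_Cons a c) = a"
  and code_tl_Cons [simp]: "code_tl (code_Cons a c) = c"
  by (simp_all add: code_hd_def code_tl_def code_Cons_def)

lemma prod_decode_0 [simp]: "prod_decode 0 = (0, 0)"
  using prod_encode_inverse[of "(0, 0)"] by (simp add: prod_encode_def)

lemma code_hd_0 [simp]: "code_hd 0 = 0"
  and code_tl_0 [simp]: "code_tl 0 = 0"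
  by (simp_all add: code_hd_def code_tl_def)

lemma code_nth_0 [simp]: "code_nth 0 i = 0"
proof -
  have "(code_tl ^^ i) 0 = 0" by (induction i) auto
  then show ?thesis by (simp add: code_nth_def)
qed

lemma code_nth_Cons: "code_nth (code_Cons a c) i = (case i of 0 \<Rightarrow> a | Suc j \<Rightarrow> code_nth c j)"
  by (cases i) (simp_all add: code_nth_def funpow_Suc_right del: funpow.simps(2))

lemma code_nth_zero: "code_nth c 0 = code_hd c"
  by (simp add: code_nth_def)

lemma code_nth_tl: "code_nth (code_tl c) i = code_nth c (Suc i)"
  by (simp add: code_nth_def funpow_Suc_right del: funpow.simps(2))

lemma list_encode_code_Cons: "list_encode (x # xs) = code_Cons x (list_encode xs)"
  by (simp add: code_Cons_def)

lemma code_nth_list_encode: "i < length xs \<Longrightarrow> code_nth (list_encode xs) i = xs ! i"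
  by (induction xs arbitrary: i)
    (auto simp: code_nth_Cons list_encode_code_Cons split: nat.split simp del: list_encode.simps(2))

lemma computable_code_hd: "computable k A \<Longrightarrow> computable k (\<lambda>xs. code_hd (A xs))"
  unfolding code_hd_def by (intro computable_fst_prod_decode computable_pred)

lemma computable_code_tl: "computable k A \<Longrightarrow> computable k (\<lambda>xs. code_tl (A xs))"
  unfolding code_tl_def by (intro computable_snd_prod_decode computable_pred)

lemma computable_code_Cons:
  "computable k A \<Longrightarrow> computable k B \<Longrightarrow> computable k (\<lambda>xs. code_Cons (A xs) (B xs))"
  unfolding code_Cons_def by (intro computable_Suc computable_prod_encode)

lemma computable_code_nth:
  assumes "computable k A" "computable k B"
  shows "computable k (\<lambda>xs. code_nth (A xs) (B xs))"
proof -
  have *: "rec_nat c (\<lambda>i r. code_tl r) i = (code_tl ^^ i) c" for c i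
    by (induction i) auto
  have "computable 2 (\<lambda>xs. code_hd (rec_nat (xs ! 0) (\<lambda>i r. code_tl r) (xs ! 1)))"
    by (intro computable_code_hd computable_rec_nat computable_code_tl computable_nth) auto
  then show ?thesis
    using computable_comp2[of code_nth, OF _ assms] unfolding code_nth_def * by blast
qed

lemmas computable_basic = computable_const computable_Suc computable_add computable_pred
  computable_diff computable_if_zero computable_if_le computable_if_less computable_if_eq
  computable_prod_encode computable_fst_prod_decode computable_snd_prod_decode
  computable_code_hd computable_code_tl computable_code_Cons computable_code_nth computable_nth

section \<open>Counter programs for recursive functions\<close>

datatype com = Skip | Inc nat | Dec nat | Emit | Seq com com (infixr ";;" 60) | While nat com

type_synonym store = "(nat \<Rightarrow> nat) \<times> nat"

text \<open>A small-step semantics with a stack of pending commands: the programs of interest never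
  terminate, and their number of signals has to be visible at arbitrarily late times.\<close>

fun com_step :: "com list \<times> store \<Rightarrow> com list \<times> store" where
  "com_step ([], \<sigma>) = ([], \<sigma>)"
| "com_step (Skip # K, \<sigma>) = (K, \<sigma>)"
| "com_step (Inc r # K, s, e) = (K, s(r := Suc (s r)), e)"
| "com_step (Dec r # K, s, e) = (K, s(r := s r - 1), e)"
| "com_step (Emit # K, s, e) = (K, s, Suc e)"
| "com_step ((a ;; b) # K, \<sigma>) = (a # b # K, \<sigma>)"
| "com_step (While r c # K, s, e) = (if s r = 0 then K else c # While r c # K, s, e)"

text \<open>The quantification over all \<open>K\<close> says that the rest of the stack is left
  alone, which makes executions composable.\<close>

definition exec :: "com \<Rightarrow> store \<Rightarrow> store \<Rightarrow> bool" where
  "exec c \<sigma> \<tau> \<longleftrightarrow> (\<forall>K. \<exists>n. (com_step ^^ n) (c # K, \<sigma>) = (K, \<tau>))"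

lemma exec_atomI: "(\<And>K. com_step (c # K, \<sigma>) = (K, \<tau>)) \<Longrightarrow> exec c \<sigma> \<tau>"
  unfolding exec_def by (metis funpow_0 funpow_Suc_right comp_apply)

lemma exec_Inc: "exec (Inc r) (s, e) (s(r := Suc (s r)), e)"
  and exec_Dec: "exec (Dec r) (s, e) (s(r := s r - 1), e)"
  and exec_Emit: "exec Emit (s, e) (s, Suc e)"
  and exec_Skip: "exec Skip \<sigma> \<sigma>"
  and exec_While_zero: "s r = 0 \<Longrightarrow> exec (While r c) (s, e) (s, e)"
  by (rule exec_atomI, simp)+

lemma funpow_add_trans: "(f ^^ m) x = y \<Longrightarrow> (f ^^ n) y = z \<Longrightarrow> (f ^^ (n + m)) x = z"
  by (simp add: funpow_add)

lemma exec_Seq: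
  assumes "exec a \<sigma> \<tau>" "exec b \<tau> \<rho>"
  shows "exec (a ;; b) \<sigma> \<rho>"
  unfolding exec_def
proof
  fix K
  obtain m where m: "(com_step ^^ m) (a # b # K, \<sigma>) = (b # K, \<tau>)"
    using assms(1) unfolding exec_def by blast
  obtain n where n: "(com_step ^^ n) (b # K, \<tau>) = (K, \<rho>)"
    using assms(2) unfolding exec_def by blast
  have "(com_step ^^ 1) ((a ;; b) # K, \<sigma>) = (a # b # K, \<sigma>)"
    by simp
  from funpow_add_trans[OF funpow_add_trans[OF this m] n]
  show "\<exists>n. (com_step ^^ n) ((a ;; b) # K, \<sigma>) = (K, \<rho>)" by blast
qed

lemma exec_While_nonzero:
  assumes "s r \<noteq> 0" "exec c (s, e) \<tau>" "exec (While r c) \<tau> \<rho>"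
  shows "exec (While r c) (s, e) \<rho>"
  unfolding exec_def
proof
  fix K
  obtain m where m: "(com_step ^^ m) (c # While r c # K, s, e) = (While r c # K, \<tau>)"
    using assms(2) unfolding exec_def by blast
  obtain n where n: "(com_step ^^ n) (While r c # K, \<tau>) = (K, \<rho>)"
    using assms(3) unfolding exec_def by blast
  have "(com_step ^^ 1) (While r c # K, s, e) = (c # While r c # K, s, e)"
    using assms(1) by simp
  from funpow_add_trans[OF funpow_add_trans[OF this m] n]
  show "\<exists>n. (com_step ^^ n) (While r c # K, s, e) = (K, \<rho>)" by blast
qed

text \<open>A loop rule with an explicit trace: \<open>\<sigma> i\<close> and
  \<open>\<epsilon> i\<close> are the store and the signal count after \<open>i\<close> rounds. The
  induction is on the rounds that remain, since \<open>exec_While_nonzero\<close> splits off the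
  first one.\<close>

lemma exec_While_iterate:
  assumes "\<And>i. i < n \<Longrightarrow> \<sigma> i r \<noteq> 0" "\<And>i. i < n \<Longrightarrow> exec c (\<sigma> i, \<epsilon> i) (\<sigma> (Suc i), \<epsilon> (Suc i))"
    and "\<sigma> n r = 0" "s = \<sigma> 0" "e = \<epsilon> 0" "s' = \<sigma> n" "e' = \<epsilon> n"
  shows "exec (While r c) (s, e) (s', e')"
proof -
  have "exec (While r c) (\<sigma> (n - i), \<epsilon> (n - i)) (\<sigma> n, \<epsilon> n)" if "i \<le> n" for i
    using that
  proof (induction i)
    case 0
    then show ?case using assms(3) exec_While_zero by simp
  next
    case (Suc i)
    then have "Suc (n - Suc i) = n - i" by simp
    then show ?case
      using exec_While_nonzero[OF assms(1)[of "n - Suc i"] assms(2)[of "n - Suc i"]] Suc by simp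
  qed
  from this[of n] show ?thesis using assms(4-) by simp
qed

section \<open>Clearing, moving and copying registers\<close>

definition clear_reg :: "nat \<Rightarrow> com" where
  "clear_reg r = While r (Dec r)"

definition move_reg :: "nat \<Rightarrow> nat \<Rightarrow> com" where
  "move_reg r d = While r (Dec r ;; Inc d)"

text \<open>Reading a counter destroys it, so a second copy is collected in the scratch register
  \<open>t\<close> and moved back.\<close>

definition copy_reg :: "nat \<Rightarrow> nat \<Rightarrow> nat \<Rightarrow> com" where
  "copy_reg t r d = While r (Dec r ;; Inc d ;; Inc t) ;; move_reg t r"

lemma exec_cong: "exec c \<sigma> \<tau> \<Longrightarrow> \<tau> = \<tau>' \<Longrightarrow> exec c \<sigma> \<tau>'"
  by simp

lemma exec_clear: "exec (clear_reg r) (s, e) (s(r := 0), e)"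
  unfolding clear_reg_def
  by (rule exec_While_iterate[where n = "s r" and \<sigma> = "\<lambda>i. s(r := s r - i)" and \<epsilon> = "\<lambda>i. e"])
    (auto intro!: exec_cong[OF exec_Dec])

lemma exec_move:
  assumes "r \<noteq> d"
  shows "exec (move_reg r d) (s, e) (s(r := 0, d := s d + s r), e)"
  unfolding move_reg_def
  by (rule exec_While_iterate[where n = "s r" and \<epsilon> = "\<lambda>i. e" and
        \<sigma> = "\<lambda>i. s(r := s r - i, d := s d + i)"])
    (use assms in \<open>auto intro!: exec_cong[OF exec_Seq[OF exec_Dec exec_Inc]]\<close>)

lemma exec_copy:
  assumes "distinct [r, d, t]" "s t = 0"
  shows "exec (copy_reg t r d) (s, e) (s(d := s d + s r), e)"
proof -
  have "exec (While r (Dec r ;; Inc d ;; Inc t)) (s, e) (s(r := 0, d := s d + s r, t := s r), e)"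
    by (rule exec_While_iterate[where n = "s r" and \<epsilon> = "\<lambda>i. e" and
          \<sigma> = "\<lambda>i. s(r := s r - i, d := s d + i, t := i)"])
      (use assms in \<open>auto intro!: exec_cong[OF exec_Seq[OF exec_Dec exec_Seq[OF exec_Inc exec_Inc]]]\<close>)
  from exec_Seq[OF this exec_move[of t r]] show ?thesis
    unfolding copy_reg_def
    by (rule exec_cong) (use assms in \<open>auto simp: fun_eq_iff\<close>)
qed

text \<open>Registers from \<open>m\<close> on are free: they hold 0 before and after the computation.\<close>

definition computes :: "com \<Rightarrow> (nat list \<Rightarrow> nat) \<Rightarrow> nat list \<Rightarrow> nat \<Rightarrow> nat \<Rightarrow> bool" where
  "computes c f rs d m \<longleftrightarrow> (\<forall>s e. (\<forall>r\<ge>m. s r = 0) \<longrightarrow> s d = 0 \<longrightarrow>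
     exec c (s, e) (s(d := f (map s rs)), e))"

text \<open>All register layouts are allowed, so that a subprogram can take its arguments and leave
  its result wherever the surrounding program needs them.\<close>

definition programmable :: "nat \<Rightarrow> (nat list \<Rightarrow> nat) \<Rightarrow> bool" where
  "programmable k f \<longleftrightarrow> (\<forall>rs d m. length rs = k \<longrightarrow> set rs \<subseteq> {..<m} \<longrightarrow> d < m \<longrightarrow> d \<notin> set rs \<longrightarrow>
     (\<exists>c. computes c f rs d m))"

lemma programmableE:
  assumes "programmable k f" "length rs = k" "set rs \<subseteq> {..<m}" "d < m" "d \<notin> set rs"
  obtains c where "\<And>s e. (\<And>r. r \<ge> m \<Longrightarrow> s r = 0) \<Longrightarrow> s d = 0 \<Longrightarrow>
    exec c (s, e) (s(d := f (map s rs)), e)"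
  using assms unfolding programmable_def computes_def by metis

lemma programmableI:
  assumes "\<And>rs d m. length rs = k \<Longrightarrow> set rs \<subseteq> {..<m} \<Longrightarrow> d < m \<Longrightarrow> d \<notin> set rs \<Longrightarrow>
    \<exists>c. \<forall>s e. (\<forall>r\<ge>m. s r = 0) \<longrightarrow> s d = 0 \<longrightarrow> exec c (s, e) (s(d := f (map s rs)), e)"
  shows "programmable k f"
  using assms unfolding programmable_def computes_def by metis

text \<open>The value of function number \<open>i\<close> goes to register \<open>m + i\<close>.
  Extending the list at its end keeps the earlier values in place: the next program treats them as
  occupied and has its free registers above its own target.\<close>

lemma programmable_tuple:
  assumes "\<And>f. f \<in> set fs \<Longrightarrow> programmable k f" "length rs = k" "set rs \<subseteq> {..<m}"
  shows "\<exists>c. \<forall>s e. (\<forall>r\<ge>m. s r = 0) \<longrightarrow> exec c (s, e)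
    (\<lambda>r. if m \<le> r \<and> r < m + length fs then (fs ! (r - m)) (map s rs) else s r, e)"
  using assms(1)
proof (induction fs rule: rev_induct)
  case Nil
  show ?case
    by (rule exI[of _ Skip]) (auto intro!: exec_cong[OF exec_Skip])
next
  case (snoc f fs)
  let ?n = "length fs"
  let ?t = "\<lambda>s r. if m \<le> r \<and> r < m + ?n then (fs ! (r - m)) (map s rs) else s r"
  have "\<exists>c. \<forall>s e. (\<forall>r\<ge>m. s r = 0) \<longrightarrow> exec c (s, e) (?t s, e)"
    by (rule snoc.IH) (use snoc.prems in auto)
  then obtain c where c: "\<And>s e. \<forall>r\<ge>m. s r = 0 \<Longrightarrow> exec c (s, e) (?t s, e)"
    by blast
  obtain c' where c': "\<And>s e. (\<And>r. r \<ge> Suc (m + ?n) \<Longrightarrow> s r = 0) \<Longrightarrow> s (m + ?n) = 0 \<Longrightarrow>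
      exec c' (s, e) (s(m + ?n := f (map s rs)), e)"
    by (rule programmableE[of k f rs "Suc (m + ?n)" "m + ?n"]) (use snoc assms in auto)
  have "exec (c ;; c') (s, e) (\<lambda>r. if m \<le> r \<and> r < m + length (fs @ [f])
    then ((fs @ [f]) ! (r - m)) (map s rs) else s r, e)" if s: "\<forall>r\<ge>m. s r = 0" for s e
  proof -
    have eq: "map (?t s) rs = map s rs"
      using assms(3) by auto
    have "exec (c ;; c') (s, e) ((?t s)(m + ?n := f (map (?t s) rs)), e)"
      by (rule exec_Seq[OF c c'[of "?t s"]]) (use s in auto)
    then show ?thesis
      unfolding eq by (rule exec_cong) (auto simp: fun_eq_iff nth_append less_Suc_eq)
  qed
  then show ?case by blast
qed

lemma clear_range: "\<exists>c. \<forall>s e. exec c (s, e) (\<lambda>r. if m \<le> r \<and> r < m + n then 0 else s r, e)"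
proof (induction n)
  case 0
  show ?case by (rule exI[of _ Skip]) (auto intro!: exec_cong[OF exec_Skip])
next
  case (Suc n)
  then obtain c where c: "\<And>s e. exec c (s, e) (\<lambda>r. if m \<le> r \<and> r < m + n then 0 else s r, e)"
    by blast
  show ?case
    by (rule exI[of _ "c ;; clear_reg (m + n)"])
      (auto intro!: exec_cong[OF exec_Seq[OF c exec_clear]] simp: fun_eq_iff)
qed

section \<open>One counter program for each scheme of recursion\<close>

lemma programmable_proj: "i < k \<Longrightarrow> programmable k (\<lambda>xs. xs ! i)"
proof (rule programmableI)
  fix rs d m assume *: "i < k" "length rs = k" "set rs \<subseteq> {..<m}" "d < (m::nat)" "d \<notin> set rs"
  then have "rs ! i \<in> set rs" by simp
  moreover from this have "rs ! i < m" using * by blast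
  ultimately have "distinct [rs ! i, d, m]" using * by auto
  with * show "\<exists>c. \<forall>s e. (\<forall>r\<ge>m. s r = 0) \<longrightarrow> s d = 0 \<longrightarrow> exec c (s, e) (s(d := map s rs ! i), e)"
    by (intro exI[of _ "copy_reg m (rs ! i) d"] allI impI exec_cong[OF exec_copy]) auto
qed

lemma programmable_succ: "programmable 1 (\<lambda>xs. Suc (xs ! 0))"
proof (rule programmableI)
  fix rs d m assume *: "length rs = 1" "set rs \<subseteq> {..<m}" "d < (m::nat)" "d \<notin> set rs"
  obtain c where c: "\<And>s e. (\<And>r. r \<ge> m \<Longrightarrow> s r = 0) \<Longrightarrow> s d = 0 \<Longrightarrow>
      exec c (s, e) (s(d := map s rs ! 0), e)"
    by (rule programmableE[OF programmable_proj[of 0 1] *]) auto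
  show "\<exists>c. \<forall>s e. (\<forall>r\<ge>m. s r = 0) \<longrightarrow> s d = 0 \<longrightarrow> exec c (s, e) (s(d := Suc (map s rs ! 0)), e)"
    by (intro exI[of _ "c ;; Inc d"] allI impI exec_cong[OF exec_Seq[OF c exec_Inc]]) auto
qed

lemma programmable_comp:
  assumes g: "programmable (length fs) g" and fs: "\<And>f. f \<in> set fs \<Longrightarrow> programmable k f"
  shows "programmable k (\<lambda>xs. g (map (\<lambda>f. f xs) fs))"
proof (rule programmableI)
  fix rs d m assume *: "length rs = k" "set rs \<subseteq> {..<m}" "d < (m::nat)" "d \<notin> set rs"
  let ?n = "length fs"
  let ?t = "\<lambda>s r. if m \<le> r \<and> r < m + ?n then (fs ! (r - m)) (map s rs) else s r"
  obtain c1 where c1: "\<And>s e. \<forall>r\<ge>m. s r = 0 \<Longrightarrow> exec c1 (s, e) (?t s, e)"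
    using programmable_tuple[OF fs *(1,2)] by blast
  obtain c2 where c2: "\<And>s e. (\<And>r. r \<ge> m + ?n \<Longrightarrow> s r = 0) \<Longrightarrow> s d = 0 \<Longrightarrow>
      exec c2 (s, e) (s(d := g (map s [m..<m + ?n])), e)"
    by (rule programmableE[OF g, of "[m..<m + ?n]" "m + ?n" d]) (use * in auto)
  obtain c3 where c3: "\<And>s e. exec c3 (s, e) (\<lambda>r. if m \<le> r \<and> r < m + ?n then 0 else s r, e)"
    using clear_range by blast
  have "exec (c1 ;; c2 ;; c3) (s, e) (s(d := g (map (\<lambda>f. f (map s rs)) fs)), e)"
    if s: "\<forall>r\<ge>m. s r = 0" "s d = 0" for s e
  proof -
    have eq: "map (?t s) [m..<m + ?n] = map (\<lambda>f. f (map s rs)) fs"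
      by (auto intro: nth_equalityI)
    have "exec (c1 ;; c2 ;; c3) (s, e)
      (\<lambda>r. if m \<le> r \<and> r < m + ?n then 0 else ((?t s)(d := g (map (?t s) [m..<m + ?n]))) r, e)"
      by (rule exec_Seq[OF c1 exec_Seq[OF c2[of "?t s"] c3]]) (use s * in auto)
    then show ?thesis
      unfolding eq by (rule exec_cong) (use s * in \<open>auto simp: fun_eq_iff\<close>)
  qed
  then show "\<exists>c. \<forall>s e. (\<forall>r\<ge>m. s r = 0) \<longrightarrow> s d = 0 \<longrightarrow>
      exec c (s, e) (s(d := g (map (\<lambda>f. f (map s rs)) fs)), e)"
    by blast
qed

lemma programmable_prec:
  assumes f: "programmable k f" and g: "programmable (Suc (Suc k)) g"
  shows "programmable (Suc k) (\<lambda>xs. rec_nat (f (tl xs)) (\<lambda>i r. g (i # r # tl xs)) (hd xs))"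
proof (rule programmableI)
  fix rs d m assume *: "length rs = Suc k" "set rs \<subseteq> {..<m}" "d < (m::nat)" "d \<notin> set rs"
  then obtain x ys where rs: "rs = x # ys" by (cases rs) auto
  let ?F = "\<lambda>s n. rec_nat (f (map s ys)) (\<lambda>i r. g (i # r # map s ys)) n"
  obtain c1 where c1: "\<And>s e. (\<And>r. r \<ge> m + 4 \<Longrightarrow> s r = 0) \<Longrightarrow> s (Suc m) = 0 \<Longrightarrow>
      exec c1 (s, e) (s(Suc m := f (map s ys)), e)"
    by (rule programmableE[OF f, of ys "m + 4" "Suc m"]) (use * rs in auto)
  obtain c2 where c2: "\<And>s e. (\<And>r. r \<ge> m + 4 \<Longrightarrow> s r = 0) \<Longrightarrow> s (m + 3) = 0 \<Longrightarrow>
      exec c2 (s, e) (s(m + 3 := g (map s (m # Suc m # ys))), e)"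
    by (rule programmableE[OF g, of "m # Suc m # ys" "m + 4" "m + 3"]) (use * rs in auto)
  \<comment> \<open>Register \<open>m\<close> holds the index, \<open>Suc m\<close> the accumulator
    and \<open>m + 2\<close> the number of rounds left. Register \<open>m + 3\<close> is the scratch
    register for copying and receives the value of \<open>g\<close> before it becomes the new
    accumulator.\<close>
  define body where
    "body = Dec (m + 2) ;; c2 ;; clear_reg (Suc m) ;; move_reg (m + 3) (Suc m) ;; Inc m"
  define c where "c = copy_reg (m + 3) x (m + 2) ;; c1 ;; While (m + 2) body ;;
    move_reg (Suc m) d ;; clear_reg m"
  have "exec c (s, e) (s(d := ?F s (s x)), e)" if s: "\<And>r. r \<ge> m \<Longrightarrow> s r = 0" "s d = 0" for s e
  proof -
    let ?\<sigma> = "\<lambda>i. s(m := i, Suc m := ?F s i, m + 2 := s x - i)"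
    have ys: "map (s(m := i, Suc m := j, Suc (Suc m) := l)) ys = map s ys" for i j l
      using * rs by auto
    have body: "exec body (?\<sigma> i, e) (?\<sigma> (Suc i), e)" for i
      unfolding body_def
      by (rule exec_cong[OF exec_Seq[OF exec_Dec exec_Seq[OF c2
            exec_Seq[OF exec_clear exec_Seq[OF exec_move exec_Inc]]]]])
        (use s rs in \<open>auto simp: fun_eq_iff ys\<close>)
    have loop: "exec (While (m + 2) body) (?\<sigma> 0, e) (?\<sigma> (s x), e)"
      by (rule exec_While_iterate[where n = "s x" and \<epsilon> = "\<lambda>i. e" and \<sigma> = ?\<sigma>])
        (rule body | simp)+
    have "x < m" using * rs by auto
    let ?s = "s(m + 2 := s x)"
    have "exec (copy_reg (m + 3) x (m + 2)) (s, e) (?s, e)"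
      by (rule exec_cong[OF exec_copy]) (use s * rs \<open>x < m\<close> in \<open>auto simp: fun_eq_iff\<close>)
    moreover have "exec c1 (?s, e) (?\<sigma> 0, e)"
      by (rule exec_cong[OF c1])
        (use s * rs in \<open>auto simp: fun_eq_iff intro!: arg_cong[of _ _ f]\<close>)
    moreover have "exec (move_reg (Suc m) d ;; clear_reg m) (?\<sigma> (s x), e) (s(d := ?F s (s x)), e)"
      by (rule exec_cong[OF exec_Seq[OF exec_move exec_clear]])
        (use s * in \<open>auto simp: fun_eq_iff\<close>)
    ultimately show ?thesis
      unfolding c_def using loop by (blast intro: exec_Seq)
  qed
  then show "\<exists>c. \<forall>s e. (\<forall>r\<ge>m. s r = 0) \<longrightarrow> s d = 0 \<longrightarrow> exec c (s, e)
      (s(d := rec_nat (f (tl (map s rs))) (\<lambda>i r. g (i # r # tl (map s rs))) (hd (map s rs))), e)"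
    using rs by auto
qed

lemma programmable_mini:
  assumes f: "programmable (Suc k) f" and ex: "\<And>xs. length xs = k \<Longrightarrow> \<exists>y. f (y # xs) = 0"
  shows "programmable k (\<lambda>xs. LEAST y. f (y # xs) = 0)"
proof (rule programmableI)
  fix rs d m assume *: "length rs = k" "set rs \<subseteq> {..<m}" "d < (m::nat)" "d \<notin> set rs"
  obtain c1 where c1: "\<And>s e. (\<And>r. r \<ge> Suc m \<Longrightarrow> s r = 0) \<Longrightarrow> s m = 0 \<Longrightarrow>
      exec c1 (s, e) (s(m := f (map s (d # rs))), e)"
    by (rule programmableE[OF f, of "d # rs" "Suc m" m]) (use * in auto)
  \<comment> \<open>The target \<open>d\<close> itself holds the candidate and \<open>m\<close> the
    value of \<open>f\<close> there. The first \<open>c1\<close> tests candidate 0; every round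
    discards the value, increments the candidate and tests again, until the value is 0.\<close>
  define c where "c = c1 ;; While m ((clear_reg m ;; Inc d) ;; c1)"
  have "exec c (s, e) (s(d := LEAST y. f (y # map s rs) = 0), e)"
    if s: "\<And>r. r \<ge> m \<Longrightarrow> s r = 0" "s d = 0" for s e
  proof -
    obtain n where n: "(LEAST y. f (y # map s rs) = 0) = n" by simp
    have zero: "f (n # map s rs) = 0" and less: "\<And>i. i < n \<Longrightarrow> f (i # map s rs) \<noteq> 0"
      using LeastI_ex[OF ex[of "map s rs"]] not_less_Least[of _ "\<lambda>y. f (y # map s rs) = 0"] * n
      by auto
    let ?\<sigma> = "\<lambda>i. s(d := i, m := f (i # map s rs))"
    have "m \<notin> set rs" using * by auto
    have body: "exec ((clear_reg m ;; Inc d) ;; c1) (?\<sigma> i, e) (?\<sigma> (Suc i), e)" for i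
    proof -
      let ?t = "s(d := Suc i)"
      have "exec (clear_reg m ;; Inc d) (?\<sigma> i, e) (?t, e)"
        by (rule exec_cong[OF exec_Seq[OF exec_clear exec_Inc]])
          (use s * in \<open>auto simp: fun_eq_iff\<close>)
      moreover have "exec c1 (?t, e) (?t(m := f (map ?t (d # rs))), e)"
        by (rule c1) (use s * in auto)
      moreover have "map ?t (d # rs) = Suc i # map s rs"
        using * by simp
      ultimately show ?thesis
        using exec_Seq by (metis (no_types))
    qed
    have "exec (While m ((clear_reg m ;; Inc d) ;; c1)) (?\<sigma> 0, e) (?\<sigma> n, e)"
      by (rule exec_While_iterate[where n = n and \<epsilon> = "\<lambda>i. e" and \<sigma> = ?\<sigma>])
        (rule body | simp add: zero less)+
    moreover have "exec c1 (s, e) (?\<sigma> 0, e)"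
      by (rule exec_cong[OF c1]) (use s * in \<open>auto simp: fun_eq_iff\<close>)
    ultimately have "exec c (s, e) (?\<sigma> n, e)"
      unfolding c_def using exec_Seq by blast
    then show ?thesis
      unfolding n by (rule exec_cong) (use s * zero in \<open>auto simp: fun_eq_iff\<close>)
  qed
  then show "\<exists>c. \<forall>s e. (\<forall>r\<ge>m. s r = 0) \<longrightarrow> s d = 0 \<longrightarrow>
      exec c (s, e) (s(d := LEAST y. f (y # map s rs) = 0), e)"
    by auto
qed

lemma programmable_recursive: "recursive k f \<Longrightarrow> programmable k f"
proof (induction rule: recursive.induct)
  case (zero k)
  show ?case
    by (rule programmableI) (auto intro!: exI[of _ Skip] exec_cong[OF exec_Skip] simp: fun_eq_iff)
qed (blast intro: programmable_succ programmable_proj programmable_comp programmable_prec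
    programmable_mini)+

section \<open>Turing machines for counter programs\<close>

type_synonym 'q trans = "'q \<Rightarrow> nat \<Rightarrow> ('q \<times> nat \<times> move \<times> nat option) option"

text \<open>The states have an arbitrary type, because the compiled machine uses command stacks as
  states, and the signals sent are counted along the run.\<close>

fun count_step :: "'q trans \<Rightarrow> ('q \<times> int \<times> (int \<Rightarrow> nat)) \<times> nat \<Rightarrow> ('q \<times> int \<times> (int \<Rightarrow> nat)) \<times> nat" where
  "count_step \<delta> ((q, i, tape), e) = (case \<delta> q (tape i) of
      None \<Rightarrow> ((q, i, tape), e)
    | Some (q', a', d, x) \<Rightarrow> ((q', move_head d i, tape(i := a')), if x = None then e else Suc e))"

definition input_tape :: "nat \<Rightarrow> int \<Rightarrow> nat" where
  "input_tape n = (\<lambda>i. if 0 \<le> i \<and> i < int n then 1 else 0)"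

lemma count_step_delta:
  "(count_step (delta P) ^^ t) (x, e) =
    ((step P ^^ t) x, e + card {u. u < t \<and> emission P ((step P ^^ u) x) \<noteq> None})"
proof (induction t)
  case (Suc t)
  let ?A = "\<lambda>t. {u. u < t \<and> emission P ((step P ^^ u) x) \<noteq> None}"
  have "?A (Suc t) = (if emission P ((step P ^^ t) x) \<noteq> None then insert t (?A t) else ?A t)"
    by (auto simp: less_Suc_eq)
  then have "card (?A (Suc t)) =
      card (?A t) + (if emission P ((step P ^^ t) x) \<noteq> None then 1 else 0)"
    by simp
  moreover obtain q i tape where "(step P ^^ t) x = (q, i, tape)"
    by (metis prod.collapse)
  ultimately show ?case
    using Suc by (auto split: option.split)
qed simp

lemma finite_machine_to_tm:
  fixes \<delta> :: "'q trans"
  assumes Q: "finite Q" "q0 \<in> Q" and "2 \<le> M"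
    and closed: "\<And>q a q' a' d x. q \<in> Q \<Longrightarrow> a < M \<Longrightarrow> \<delta> q a = Some (q', a', d, x) \<Longrightarrow>
      q' \<in> Q \<and> a' < M \<and> (\<forall>y. x = Some y \<longrightarrow> y < G)"
  obtains P and h :: "'q \<Rightarrow> nat" where "wf_tm P" "signals P = G"
    "\<And>n t q i tape e. (count_step \<delta> ^^ t) ((q0, 0, input_tape n), 0) = ((q, i, tape), e) \<Longrightarrow>
      (count_step (delta P) ^^ t) (init_config n, 0) = ((h q, i, tape), e)"
proof -
  obtain h0 where h0: "bij_betw h0 Q {..<card Q}"
    using ex_bij_betw_finite_nat[OF Q(1)] atLeast0LessThan by metis
  \<comment> \<open>The transposition moves the start state to number 0, where
    \<open>init_config\<close> begins.\<close>
  define h where "h = Transposition.transpose 0 (h0 q0) \<circ> h0"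
  have pos: "0 < card Q"
    using Q by (auto simp: card_gt_0_iff)
  have h0_less: "h0 q0 < card Q"
    using h0 Q(2) by (auto simp: bij_betw_def)
  have h: "bij_betw h Q {..<card Q}"
    unfolding h_def using pos h0_less by (intro bij_betw_trans[OF h0] bij_betw_transpose_iff) simp
  have h_q0: "h q0 = 0"
    by (simp add: h_def)
  define D where "D q a = (if q < card Q then
    map_option (\<lambda>(q', r). (h q', r)) (\<delta> (the_inv_into Q h q) a) else None)" for q a
  define P where "P = \<lparr>states = card Q, symbols = M, signals = G, delta = D\<rparr>"
  have inv: "the_inv_into Q h q \<in> Q" if "q < card Q" for q
    using h that by (metis bij_betw_def lessThan_iff the_inv_into_into subset_refl)
  have h_less: "h q < card Q" if "q \<in> Q" for q
    using h that by (auto simp: bij_betw_def)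
  have D_h: "D (h q) a = map_option (\<lambda>(q', r). (h q', r)) (\<delta> q a)" if "q \<in> Q" for q a
    using that h h_less by (simp add: D_def the_inv_into_f_f bij_betw_def)
  have "wf_tm P"
    unfolding wf_tm_def
  proof (intro conjI allI impI)
    fix q a q' a' d e
    assume "q < states P" "a < symbols P" "delta P q a = Some (q', a', d, e)"
    then have q: "q < card Q" "a < M" "D q a = Some (q', a', d, e)"
      by (simp_all add: P_def)
    then obtain p where "\<delta> (the_inv_into Q h q) a = Some (p, a', d, e)" "q' = h p"
      by (auto simp: D_def)
    from closed[OF inv[OF q(1)] q(2) this(1)] this(2)
    show "q' < states P" "a' < symbols P" "\<And>x. e = Some x \<Longrightarrow> x < signals P"
      using h_less by (auto simp: P_def)
  qed (use pos \<open>2 \<le> M\<close> in \<open>auto simp: P_def\<close>)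
  moreover have "signals P = G"
    by (simp add: P_def)
  \<comment> \<open>The invariants on the state and the tape are carried along because the two
    transition functions correspond only on \<open>Q\<close>, and \<open>Q\<close> is closed only
    under reading symbols below \<open>M\<close>.\<close>
  moreover have "(count_step (delta P) ^^ t) (init_config n, 0) = ((h q, i, tape), e) \<and>
      q \<in> Q \<and> (\<forall>j. tape j < M)"
    if "(count_step \<delta> ^^ t) ((q0, 0, input_tape n), 0) = ((q, i, tape), e)" for n t q i tape e
    using that
  proof (induction t arbitrary: q i tape e)
    case 0
    then show ?case
      using Q \<open>2 \<le> M\<close> h_q0 by (auto simp: init_config_def input_tape_def)
  next
    case (Suc t)
    obtain p j T f where *: "(count_step \<delta> ^^ t) ((q0, 0, input_tape n), 0) = ((p, j, T), f)"
      by (metis prod.collapse)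
    note IH = Suc.IH[OF this]
    then have "delta P (h p) (T j) = map_option (\<lambda>(q', r). (h q', r)) (\<delta> p (T j))"
      using D_h by (simp add: P_def)
    with IH Suc.prems * show ?case
      using closed[of p "T j"] by (auto split: option.splits)
  qed
  ultimately show thesis
    using that by blast
qed

section \<open>A machine whose control states are command stacks\<close>

datatype phase = Start | Work | Unmark | Return

text \<open>A symbol is the set of tracks marked in a cell. \<open>Inc\<close> and
  \<open>Dec\<close> scan right from cell 0 to the first cell off track \<open>r\<close>.
  \<open>Inc\<close> marks it; \<open>Dec\<close> steps back and erases the last mark in phase
  \<open>Unmark\<close>. \<open>Return\<close> walks left to the marker \<open>k\<close>. If the
  register was 0, \<open>Unmark\<close> stands on cell -1, where no track is marked, and one step to
  the right leads back to cell 0. \<open>While\<close> needs no scan: a register is nonzero iff its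
  track is marked in cell 0.\<close>

fun com_trans :: "nat \<Rightarrow> com list \<times> phase \<Rightarrow> nat set \<Rightarrow>
    ((com list \<times> phase) \<times> nat set \<times> move \<times> nat option) option" where
  "com_trans k (K, Start) A = Some ((K, Work), insert k A, MStay, None)"
| "com_trans k (K, Return) A =
    (if k \<in> A then Some ((K, Work), A, MStay, None) else Some ((K, Return), A, MLeft, None))"
| "com_trans k (Dec r # K, Unmark) A =
    (if r \<in> A then Some ((K, Return), A - {r}, MStay, None) else Some ((K, Work), A, MRight, None))"
| "com_trans k (Dec r # K, Work) A =
    (if r \<in> A then Some ((Dec r # K, Work), A, MRight, None)
     else Some ((Dec r # K, Unmark), A, MLeft, None))"
| "com_trans k (Inc r # K, Work) A =
    (if r \<in> A then Some ((Inc r # K, Work), A, MRight, None)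
     else Some ((K, Return), insert r A, MStay, None))"
| "com_trans k (Skip # K, Work) A = Some ((K, Work), A, MStay, None)"
| "com_trans k (Emit # K, Work) A = Some ((K, Work), A, MStay, Some 0)"
| "com_trans k ((a ;; b) # K, Work) A = Some ((a # b # K, Work), A, MStay, None)"
| "com_trans k (While r c # K, Work) A =
    Some ((if r \<in> A then c # While r c # K else K, Work), A, MStay, None)"
| "com_trans k q A = None"

definition tm_trans :: "nat \<Rightarrow> (com list \<times> phase) trans" where
  "tm_trans k q a = map_option (\<lambda>(q', A, r). (q', set_encode A, r)) (com_trans k q (set_decode a))"

fun regs :: "com \<Rightarrow> nat set" where
  "regs (Inc r) = {r}"
| "regs (Dec r) = {r}"
| "regs (a ;; b) = regs a \<union> regs b"
| "regs (While r c) = insert r (regs c)"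
| "regs c = {}"

lemma finite_regs: "finite (regs c)"
  by (induction c) auto

definition bounded_regs :: "nat \<Rightarrow> com list \<Rightarrow> bool" where
  "bounded_regs k K \<longleftrightarrow> (\<forall>c\<in>set K. \<forall>r\<in>regs c. r < k)"

text \<open>An upper bound, independent of register values, for the stacks met before
  \<open>K\<close> is exposed. It is finite because a loop body returns to the very stack from which
  the loop was entered; this is what allows stacks to serve as control states.\<close>

fun reach :: "com \<Rightarrow> com list \<Rightarrow> com list set" where
  "reach (a ;; b) K = insert ((a ;; b) # K) (reach a (b # K) \<union> reach b K)"
| "reach (While r c) K = insert (While r c # K) (reach c (While r c # K))"
| "reach c K = {c # K}"

fun succs :: "com list \<Rightarrow> com list set" where
  "succs [] = {}"
| "succs ((a ;; b) # K) = {a # b # K}"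
| "succs (While r c # K) = {K, c # While r c # K}"
| "succs (c # K) = {K}"

lemma finite_reach: "finite (reach c K)"
  by (induction c K rule: reach.induct) auto

lemma Cons_in_reach: "c # K \<in> reach c K"
  by (cases c) auto

lemma succs_reach: "L \<in> reach c K \<Longrightarrow> succs L \<subseteq> insert K (reach c K)"
proof (induction c K rule: reach.induct)
  case (1 a b K)
  then show ?case
    using Cons_in_reach[of a "b # K"] Cons_in_reach[of b K] by auto
next
  case (2 r c K)
  then show ?case
    using Cons_in_reach[of c "While r c # K"] by auto
qed auto

lemma bounded_regs_reach: "L \<in> reach c K \<Longrightarrow> bounded_regs k (c # K) \<Longrightarrow> bounded_regs k L"
  by (induction c K rule: reach.induct) (auto simp: bounded_regs_def)

lemma bounded_regs_com_step: "bounded_regs k K \<Longrightarrow> bounded_regs k (fst (com_step (K, \<sigma>)))"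
  by (cases "(K, \<sigma>)" rule: com_step.cases) (auto simp: bounded_regs_def)

lemma com_trans_stack:
  "com_trans k (K, p) A = Some ((K', p'), A', d, x) \<Longrightarrow> K' \<in> insert K (succs K)"
  by (cases "(k, (K, p), A)" rule: com_trans.cases) (auto split: if_splits)

lemma com_trans_symbol:
  "com_trans k (K, p) A = Some (q, A', d, x) \<Longrightarrow> bounded_regs k K \<Longrightarrow> A \<subseteq> {..k} \<Longrightarrow> A' \<subseteq> {..k}"
  by (cases "(k, (K, p), A)" rule: com_trans.cases)
    (auto simp: bounded_regs_def split: if_splits)

lemma com_trans_signal:
  "com_trans k (K, p) A = Some (q, A', d, Some y) \<Longrightarrow> y = 0"
  by (cases "(k, (K, p), A)" rule: com_trans.cases) (auto split: if_splits)

lemma set_decode_subset: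
  assumes "a < 2 ^ m"
  shows "set_decode a \<subseteq> {..<m}"
proof
  fix x assume x: "x \<in> set_decode a"
  show "x \<in> {..<m}"
  proof (rule ccontr)
    assume "x \<notin> {..<m}"
    then have "(2::nat) ^ m \<le> 2 ^ x" by (intro power_increasing) auto
    with assms have "a div 2 ^ x = 0" by (intro div_less) linarith
    with x show False by (simp add: set_decode_def)
  qed
qed

lemma set_encode_less:
  assumes "A \<subseteq> {..<m}"
  shows "set_encode A < 2 ^ m"
proof -
  have "set_encode A \<le> (\<Sum>i<m. 2 ^ i)"
    unfolding set_encode_def using assms by (intro sum_mono2) auto
  also have "\<dots> < 2 ^ m"
    by (induction m) auto
  finally show ?thesis .
qed

text \<open>Register \<open>r < k\<close> is written in unary on track \<open>r\<close>; track \<open>k\<close> marks cell 0.\<close>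

definition track :: "nat \<Rightarrow> (nat \<Rightarrow> nat) \<Rightarrow> int \<Rightarrow> nat set" where
  "track k s i = {r. r \<le> k \<and> 0 \<le> i \<and> i < int ((s(k := 1)) r)}"

definition store_tape :: "nat \<Rightarrow> (nat \<Rightarrow> nat) \<Rightarrow> int \<Rightarrow> nat" where
  "store_tape k s i = set_encode (track k s i)"

lemma finite_track: "finite (track k s i)"
  by (rule finite_subset[of _ "{..k}"]) (auto simp: track_def)

lemma tm_trans_store_tape:
  "tm_trans k q (store_tape k s i) =
    map_option (\<lambda>(q', A, r). (q', set_encode A, r)) (com_trans k q (track k s i))"
  by (simp add: tm_trans_def store_tape_def finite_track)

lemma in_track: "r < k \<Longrightarrow> r \<in> track k s i \<longleftrightarrow> 0 \<le> i \<and> i < int (s r)"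
  and marker_in_track: "k \<in> track k s i \<longleftrightarrow> i = 0"
  by (auto simp: track_def)

lemma store_tape_insert:
  assumes "r < k"
  shows "(store_tape k s)(int (s r) := set_encode (insert r (track k s (int (s r))))) =
    store_tape k (s(r := Suc (s r)))"
proof
  fix i
  have "insert r (track k s (int (s r))) = track k (s(r := Suc (s r))) (int (s r))"
    using assms by (auto simp: track_def)
  moreover have "track k s i = track k (s(r := Suc (s r))) i" if "i \<noteq> int (s r)"
    using assms that by (auto simp: track_def)
  ultimately show "((store_tape k s)(int (s r) := set_encode (insert r (track k s (int (s r)))))) i =
      store_tape k (s(r := Suc (s r))) i"
    by (simp add: store_tape_def)
qed

lemma store_tape_remove:
  assumes "r < k" "s r = Suc v"
  shows "(store_tape k s)(int v := set_encode (track k s (int v) - {r})) =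
    store_tape k (s(r := v))"
proof
  fix i
  have "track k s (int v) - {r} = track k (s(r := v)) (int v)"
    using assms by (auto simp: track_def)
  moreover have "track k s i = track k (s(r := v)) i" if "i \<noteq> int v"
    using assms that by (auto simp: track_def)
  ultimately show "((store_tape k s)(int v := set_encode (track k s (int v) - {r}))) i =
      store_tape k (s(r := v)) i"
    by (simp add: store_tape_def)
qed

lemma store_tape_upd_same [simp]:
  "(store_tape k s)(i := set_encode (track k s i)) = store_tape k s"
  by (auto simp: store_tape_def)

lemma return_run:
  "\<exists>n. (count_step (tm_trans k) ^^ n) (((K, Return), int j, store_tape k s), e) =
    (((K, Work), 0, store_tape k s), e)"
proof (induction j)
  case 0
  show ?case
    by (rule exI[of _ 1]) (simp add: tm_trans_store_tape marker_in_track)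
next
  case (Suc j)
  then obtain n where "(count_step (tm_trans k) ^^ n) (((K, Return), int j, store_tape k s), e) =
      (((K, Work), 0, store_tape k s), e)" by blast
  moreover have "(count_step (tm_trans k) ^^ 1) (((K, Return), int (Suc j), store_tape k s), e) =
      (((K, Return), int j, store_tape k s), e)"
    by (simp add: tm_trans_store_tape marker_in_track)
  ultimately show ?case using funpow_add_trans by metis
qed

lemma scan_run:
  assumes "c = Inc r \<or> c = Dec r" "r < k" "j \<le> s r"
  shows "(count_step (tm_trans k) ^^ j) (((c # K, Work), 0, store_tape k s), e) =
    (((c # K, Work), int j, store_tape k s), e)"
  using assms(3)
proof (induction j)
  case (Suc j)
  then show ?case
    using assms(1,2) by (auto simp: tm_trans_store_tape in_track)
qed simp

text \<open>The bound \<open>n \<ge> 1\<close> ensures that the machine never runs ahead of the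
  program, so late stages of the program correspond to late times of the machine. On the empty stack
  both sides idle.\<close>

lemma com_step_simulation:
  assumes "bounded_regs k K" "com_step (K, s, e) = (K', s', e')"
  shows "\<exists>n\<ge>1. (count_step (tm_trans k) ^^ n) (((K, Work), 0, store_tape k s), e) =
    (((K', Work), 0, store_tape k s'), e')"
proof -
  let ?f = "count_step (tm_trans k)"
  have one: ?thesis if "?f (((K, Work), 0, store_tape k s), e) = (((K', Work), 0, store_tape k s'), e')"
    by (rule exI[of _ 1]) (use that in simp)
  show ?thesis
  proof (cases "(K, s, e)" rule: com_step.cases)
    case (3 r L s'' e'')
    then have r: "r < k" "K = Inc r # L" "K' = L" "s' = s(r := Suc (s r))" "e' = e"
      using assms by (auto simp: bounded_regs_def)
    have "(?f ^^ 1) (((K, Work), int (s r), store_tape k s), e) =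
        (((L, Return), int (s r), store_tape k s'), e)"
      using r by (simp add: tm_trans_store_tape in_track store_tape_insert)
    from funpow_add_trans[OF scan_run[of "Inc r" r k "s r" s L e] this[unfolded r(2)]]
    have "(?f ^^ (1 + s r)) (((K, Work), 0, store_tape k s), e) =
        (((L, Return), int (s r), store_tape k s'), e)"
      using r by simp
    moreover obtain n where "(?f ^^ n) (((L, Return), int (s r), store_tape k s'), e) =
        (((L, Work), 0, store_tape k s'), e)"
      using return_run by blast
    ultimately have "(?f ^^ (n + (1 + s r))) (((K, Work), 0, store_tape k s), e) =
        (((K', Work), 0, store_tape k s'), e')"
      unfolding r(3,5) by (rule funpow_add_trans)
    then show ?thesis by (intro exI[of _ "n + (1 + s r)"]) auto
  next
    case (4 r L s'' e'')
    then have r: "r < k" "K = Dec r # L" "K' = L" "s' = s(r := s r - 1)" "e' = e"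
      using assms by (auto simp: bounded_regs_def)
    have "(?f ^^ 1) (((K, Work), int (s r), store_tape k s), e) =
        (((K, Unmark), int (s r) - 1, store_tape k s), e)"
      using r by (simp add: tm_trans_store_tape in_track)
    from funpow_add_trans[OF scan_run[of "Dec r" r k "s r" s L e] this[unfolded r(2)]]
    have scan: "(?f ^^ (1 + s r)) (((K, Work), 0, store_tape k s), e) =
        (((K, Unmark), int (s r) - 1, store_tape k s), e)"
      using r by simp
    show ?thesis
    proof (cases "s r")
      case 0
      then have "(?f ^^ 1) (((K, Unmark), int (s r) - 1, store_tape k s), e) =
          (((K', Work), 0, store_tape k s'), e')"
        using r by (auto simp: tm_trans_store_tape in_track fun_upd_idem)
      from funpow_add_trans[OF scan this] show ?thesis
        by (intro exI[of _ "1 + (1 + s r)"]) auto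
    next
      case (Suc v)
      then have "(?f ^^ 1) (((K, Unmark), int (s r) - 1, store_tape k s), e) =
          (((L, Return), int v, store_tape k s'), e)"
        using r by (simp add: tm_trans_store_tape in_track store_tape_remove)
      note scan' = funpow_add_trans[OF scan this]
      obtain n where "(?f ^^ n) (((L, Return), int v, store_tape k s'), e) =
          (((L, Work), 0, store_tape k s'), e)"
        using return_run by blast
      from funpow_add_trans[OF scan' this] show ?thesis
        unfolding r(3,5) by (intro exI[of _ "n + (1 + (1 + s r))"]) auto
    qed
  next
    case (7 r c L s'' e'')
    show ?thesis
      by (rule one) (use 7 assms in \<open>auto simp: tm_trans_store_tape in_track bounded_regs_def\<close>)
  qed (use assms in \<open>auto intro!: one simp: tm_trans_store_tape in_track bounded_regs_def tm_trans_def\<close>)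
qed

lemma com_run_simulation:
  assumes "bounded_regs k K" "(com_step ^^ m) (K, s, e) = (K', s', e')"
  shows "\<exists>n\<ge>m. (count_step (tm_trans k) ^^ n) (((K, Work), 0, store_tape k s), e) =
    (((K', Work), 0, store_tape k s'), e')"
  using assms
proof (induction m arbitrary: K s e)
  case 0
  then show ?case by (intro exI[of _ 0]) simp
next
  case (Suc m)
  obtain L t f where 1: "com_step (K, s, e) = (L, t, f)"
    by (metis prod.collapse)
  obtain n1 where n1: "n1 \<ge> 1" "(count_step (tm_trans k) ^^ n1) (((K, Work), 0, store_tape k s), e) =
      (((L, Work), 0, store_tape k t), f)"
    using com_step_simulation[OF Suc.prems(1) 1] by blast
  have "bounded_regs k L"
    using bounded_regs_com_step[OF Suc.prems(1)] 1 by (metis fst_conv)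
  moreover have "(com_step ^^ m) (L, t, f) = (K', s', e')"
    using Suc.prems(2) 1 by (simp add: funpow_Suc_right del: funpow.simps(2))
  ultimately obtain n2 where n2: "n2 \<ge> m" "(count_step (tm_trans k) ^^ n2) (((L, Work), 0, store_tape k t), f) =
      (((K', Work), 0, store_tape k s'), e')"
    using Suc.IH by blast
  from funpow_add_trans[OF n1(2) n2(2)] n1(1) n2(1) show ?case
    by (intro exI[of _ "n2 + n1"]) auto
qed

definition input_store :: "nat \<Rightarrow> nat \<Rightarrow> nat" where
  "input_store n = (\<lambda>_. 0)(0 := n)"

text \<open>The symbol 1 codes the set \<open>{0}\<close> and the blank codes the empty set, so the
  unary input already is register 0 on its track. Only the marker at cell 0 has to be added.\<close>

lemma start_step:
  assumes "0 < k"
  shows "count_step (tm_trans k) (((K, Start), 0, input_tape n), e) =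
    (((K, Work), 0, store_tape k (input_store n)), e)"
proof -
  have decode: "set_decode (input_tape n i) = (if 0 \<le> i \<and> i < int n then {0} else {})" for i
    using set_encode_inverse[of "{0}"] by (auto simp: input_tape_def)
  have "(input_tape n)(0 := set_encode (insert k (set_decode (input_tape n 0)))) =
      store_tape k (input_store n)"
  proof
    fix i
    have "insert k (set_decode (input_tape n 0)) = track k (input_store n) 0"
      unfolding decode using assms by (auto simp: track_def input_store_def)
    moreover have "set_decode (input_tape n i) = track k (input_store n) i" if "i \<noteq> 0"
      unfolding decode using assms that by (auto simp: track_def input_store_def)
    then have "input_tape n i = store_tape k (input_store n) i" if "i \<noteq> 0"
      using that by (metis set_decode_inverse store_tape_def)
    ultimately show "((input_tape n)(0 := set_encode (insert k (set_decode (input_tape n 0))))) i =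
        store_tape k (input_store n) i"
      by (simp add: store_tape_def)
  qed
  then show ?thesis
    by (simp add: tm_trans_def)
qed

text \<open>Machine and program are not synchronised, so the signal count is matched only at some
  time \<open>t \<ge> m\<close>. As the count is monotone in time, this still determines the total
  number of signals.\<close>

lemma com_to_tm:
  obtains P where "wf_tm P" "signals P = 1"
    "\<And>n m K s e. (com_step ^^ m) ([c], input_store n, 0) = (K, s, e) \<Longrightarrow>
      \<exists>t\<ge>m. card {u. u < t \<and> emitted_at P n u \<noteq> None} = e"
proof -
  obtain k where k: "0 < k" "regs c \<subseteq> {..<k}"
    using finite_nat_iff_bounded[THEN iffD1, OF finite_regs[of c]]
    by (metis lessThan_subset_iff order_trans le_SucI order_refl zero_less_Suc)
  define S where "S = insert [] (reach c [])"
  have bounded: "bounded_regs k K" if "K \<in> S" for K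
    using that k bounded_regs_reach[of K c "[]" k] by (auto simp: S_def bounded_regs_def)
  have succs: "succs K \<subseteq> S" if "K \<in> S" for K
    using that succs_reach[of K c "[]"] by (auto simp: S_def)
  have "finite S"
    by (simp add: S_def finite_reach)
  define Q where "Q = S \<times> {Start, Work, Unmark, Return}"
  have closed: "q' \<in> Q \<and> a' < 2 ^ Suc k \<and> (\<forall>y. x = Some y \<longrightarrow> y < 1)"
    if q: "q \<in> Q" and a: "a < 2 ^ Suc k" and tr: "tm_trans k q a = Some (q', a', d, x)" for q a q' a' d x
  proof -
    obtain K p K' p' A where q_eq: "q = (K, p)" "q' = (K', p')" "a' = set_encode A"
        and t: "com_trans k (K, p) (set_decode a) = Some ((K', p'), A, d, x)"
      by (cases q; cases q') (use tr in \<open>auto simp: tm_trans_def\<close>)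
    have K: "K \<in> S" using q q_eq by (auto simp: Q_def)
    have "K' \<in> S"
      using com_trans_stack[OF t] succs[OF K] K by blast
    moreover have "p' \<in> {Start, Work, Unmark, Return}"
      by (cases p') auto
    moreover have "A \<subseteq> {..k}"
      using com_trans_symbol[OF t bounded[OF K]] set_decode_subset[OF a] lessThan_Suc_atMost by simp
    then have "a' < 2 ^ Suc k"
      using set_encode_less[of A "Suc k"] q_eq lessThan_Suc_atMost by simp
    ultimately show ?thesis
      using com_trans_signal[of k K p "set_decode a" "(K', p')" A d] t q_eq by (auto simp: Q_def)
  qed
  have "finite Q" "([c], Start) \<in> Q"
    using \<open>finite S\<close> Cons_in_reach[of c "[]"] by (auto simp: Q_def S_def)
  moreover have "2 \<le> (2::nat) ^ Suc k"
    by simp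
  ultimately obtain P h where P: "wf_tm P" "signals P = 1" and run:
    "\<And>n t q i tape e. (count_step (tm_trans k) ^^ t) ((([c], Start), 0, input_tape n), 0) = ((q, i, tape), e) \<Longrightarrow>
      (count_step (delta P) ^^ t) (init_config n, 0) = ((h q, i, tape), e)"
    using finite_machine_to_tm[of Q "([c], Start)" "2 ^ Suc k" "tm_trans k" 1] closed by metis
  show thesis
  proof (rule that[OF P])
    fix n m K s e
    assume *: "(com_step ^^ m) ([c], input_store n, 0) = (K, s, e)"
    have "bounded_regs k [c]"
      using k by (auto simp: bounded_regs_def)
    then obtain t where t: "t \<ge> m" "(count_step (tm_trans k) ^^ t) ((([c], Work), 0, store_tape k (input_store n)), 0) =
        (((K, Work), 0, store_tape k s), e)"
      using com_run_simulation[OF _ *] by blast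
    have "(count_step (tm_trans k) ^^ 1) ((([c], Start), 0, input_tape n), 0) =
        ((([c], Work), 0, store_tape k (input_store n)), 0)"
      using start_step[OF k(1)] by simp
    from run[OF funpow_add_trans[OF this t(2)]]
    have "card {u. u < t + 1 \<and> emitted_at P n u \<noteq> None} = e"
      unfolding count_step_delta emitted_at_def by simp
    then show "\<exists>t\<ge>m. card {u. u < t \<and> emitted_at P n u \<noteq> None} = e"
      using t(1) by (intro exI[of _ "t + 1"]) auto
  qed
qed

section \<open>An endless program that sends \<open>f [u, n]\<close> signals in round
  \<open>u\<close>\<close>

lemma emission_program:
  assumes "recursive 2 f"
  obtains c where "\<And>n t. \<exists>m\<ge>t. \<exists>K s. (com_step ^^ m) ([c], input_store n, 0) = (K, s, \<Sum>u<t. f [u, n])"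
proof -
  obtain c where c: "\<And>s e. (\<And>r. r \<ge> 4 \<Longrightarrow> s r = 0) \<Longrightarrow> s 2 = 0 \<Longrightarrow>
      exec c (s, e) (s(2 := f (map s [1, 0])), e)"
    by (rule programmableE[OF programmable_recursive[OF assms], of "[1, 0]" 4 2]) auto
  \<comment> \<open>Register 0 keeps the input, 1 counts the rounds, 2 receives the value of
    \<open>f\<close> and is drained by \<open>emit\<close>. Register 3 is set to 1 once and never
    changed, so the loop on it does not end.\<close>
  define emit where "emit = While 2 (Dec 2 ;; Emit)"
  define body where "body = c ;; emit ;; Inc 1"
  let ?s = "\<lambda>n t. (input_store n)(1 := t, 3 := 1)"
  have emit: "exec emit (s, e) (s(2 := 0), e + s 2)" for s e
    unfolding emit_def
    by (rule exec_While_iterate[where n = "s 2" and \<sigma> = "\<lambda>i. s(2 := s 2 - i)" and \<epsilon> = "\<lambda>i. e + i"])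
      (auto intro!: exec_cong[OF exec_Seq[OF exec_Dec exec_Emit]])
  have body: "exec body (?s n t, e) (?s n (Suc t), e + f [t, n])" for n t e
    unfolding body_def
    by (rule exec_cong[OF exec_Seq[OF c exec_Seq[OF emit exec_Inc]]])
      (auto simp: input_store_def fun_eq_iff)
  have run: "\<exists>m\<ge>t. (com_step ^^ m) ([Inc 3 ;; While 3 body], input_store n, 0) =
      ([While 3 body], ?s n t, \<Sum>u<t. f [u, n])" for n t
  proof (induction t)
    case 0
    have "(com_step ^^ 2) ([Inc 3 ;; While 3 body], input_store n, 0) =
        ([While 3 body], (input_store n)(3 := Suc 0), 0)"
      by (simp add: numeral_2_eq_2 input_store_def)
    moreover have "(input_store n)(3 := Suc 0) = ?s n 0"
      by (auto simp: input_store_def)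
    ultimately have "(com_step ^^ 2) ([Inc 3 ;; While 3 body], input_store n, 0) =
        ([While 3 body], ?s n 0, \<Sum>u<0. f [u, n])"
      by (simp only: lessThan_0 sum.empty)
    then show ?case by blast
  next
    case (Suc t)
    then obtain m where m: "m \<ge> t" "(com_step ^^ m) ([Inc 3 ;; While 3 body], input_store n, 0) =
      ([While 3 body], ?s n t, \<Sum>u<t. f [u, n])" by blast
    have while: "(com_step ^^ 1) ([While 3 body], ?s n t, \<Sum>u<t. f [u, n]) =
        ([body, While 3 body], ?s n t, \<Sum>u<t. f [u, n])"
      by simp
    obtain l where l: "(com_step ^^ l) ([body, While 3 body], ?s n t, \<Sum>u<t. f [u, n]) =
        ([While 3 body], ?s n (Suc t), (\<Sum>u<t. f [u, n]) + f [t, n])"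
      using body unfolding exec_def by blast
    from funpow_add_trans[OF funpow_add_trans[OF m(2) while] l] show ?case
      using m(1) by (intro exI[of _ "l + (1 + m)"]) auto
  qed
  show thesis
    by (rule that[of "Inc 3 ;; While 3 body"]) (use run in blast)
qed

theorem tm_of_computable:
  assumes "computable 2 f"
  obtains P where "wf_tm P" "signals P = 1"
    "\<And>n N. eventually (\<lambda>t. (\<Sum>u<t. f [u, n]) = N) sequentially \<Longrightarrow>
      finite (emission_times P n) \<and> card (emission_times P n) = N"
proof -
  obtain g where g: "recursive 2 g" "\<And>xs. length xs = 2 \<Longrightarrow> g xs = f xs"
    using assms unfolding computable_def by blast
  obtain c where c: "\<And>n t. \<exists>m\<ge>t. \<exists>K s. (com_step ^^ m) ([c], input_store n, 0) = (K, s, \<Sum>u<t. g [u, n])"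
    using emission_program[OF g(1)] by blast
  obtain P where P: "wf_tm P" "signals P = 1"
    and cnt: "\<And>n m K s e. (com_step ^^ m) ([c], input_store n, 0) = (K, s, e) \<Longrightarrow>
      \<exists>t\<ge>m. card {u. u < t \<and> emitted_at P n u \<noteq> None} = e"
    using com_to_tm[of c] by blast
  show thesis
  proof (rule that[OF P])
    fix n N
    assume "eventually (\<lambda>t. (\<Sum>u<t. f [u, n]) = N) sequentially"
    then obtain T where T: "\<And>t. t \<ge> T \<Longrightarrow> (\<Sum>u<t. g [u, n]) = N"
      using g(2) by (auto simp: eventually_sequentially)
    let ?A = "\<lambda>t. {u. u < t \<and> emitted_at P n u \<noteq> None}"
    have large: "\<exists>t\<ge>l. card (?A t) = N" for l
    proof -
      obtain m K s where "m \<ge> max l T"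
        "(com_step ^^ m) ([c], input_store n, 0) = (K, s, \<Sum>u<max l T. g [u, n])"
        using c by blast
      from cnt[OF this(2)] this(1) obtain t where
        "t \<ge> max l T" "card (?A t) = (\<Sum>u<max l T. g [u, n])"
        using order_trans by blast
      with T[of "max l T"] show ?thesis by (intro exI[of _ t]) simp
    qed
    then obtain t0 where t0: "card (?A t0) = N" by blast
    \<comment> \<open>The sets \<open>?A t\<close> grow with \<open>t\<close> and have
      \<open>N\<close> elements at arbitrarily late times; nested finite sets of equal size
      coincide, so no signal is sent from \<open>t0\<close> on.\<close>
    have "emission_times P n = ?A t0"
    proof (intro equalityI subsetI)
      fix u assume u: "u \<in> emission_times P n"
      obtain t where t: "t \<ge> max t0 (Suc u)" "card (?A t) = N"
        using large by blast
      then have "?A t0 \<subseteq> ?A t" by auto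
      then have "?A t0 = ?A t"
        using t0 t by (intro card_subset_eq) auto
      then show "u \<in> ?A t0"
        using u t by (auto simp: emission_times_def)
    qed (auto simp: emission_times_def)
    then show "finite (emission_times P n) \<and> card (emission_times P n) = N"
      using t0 by simp
  qed
qed

section \<open>Universal simulation and limit computability\<close>

fun code_move :: "move \<Rightarrow> nat" where
  "code_move MLeft = 0"
| "code_move MStay = 1"
| "code_move MRight = 2"

fun code_option :: "nat option \<Rightarrow> nat" where
  "code_option None = 0"
| "code_option (Some x) = Suc x"

fun code_trans :: "(nat \<times> nat \<times> move \<times> nat option) option \<Rightarrow> nat" where
  "code_trans None = 0"
| "code_trans (Some (q, a, d, x)) =
    Suc (prod_encode (q, prod_encode (a, prod_encode (code_move d, code_option x))))"

text \<open>Only the entries for actual states and symbols are prescribed, so a machine has many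
  codes. The diagonal argument needs just one.\<close>

definition tm_code :: "tm \<Rightarrow> nat \<Rightarrow> bool" where
  "tm_code P e \<longleftrightarrow> (\<forall>q<states P. \<forall>a<symbols P. code_nth e (prod_encode (q, a)) = code_trans (delta P q a))"

lemma ex_tm_code: "\<exists>e. tm_code P e"
proof -
  have "finite (prod_encode ` ({..<states P} \<times> {..<symbols P}))" by simp
  then obtain N where N: "prod_encode ` ({..<states P} \<times> {..<symbols P}) \<subseteq> {..<N}"
    using finite_nat_iff_bounded by blast
  let ?e = "list_encode (map (\<lambda>j. code_trans (case_prod (delta P) (prod_decode j))) [0..<N])"
  have "tm_code P ?e"
    unfolding tm_code_def
  proof (intro allI impI)
    fix q a assume "q < states P" "a < symbols P"
    then have "prod_encode (q, a) < N" using N by auto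
    then show "code_nth ?e (prod_encode (q, a)) = code_trans (delta P q a)"
      by (simp add: code_nth_list_encode)
  qed
  then show ?thesis by blast
qed

text \<open>A configuration is coded by the state, the cells left of the head and the cells from the head
  on, both read away from the head.\<close>

definition conf_state :: "nat \<Rightarrow> nat" where
  "conf_state c = fst (prod_decode c)"

definition conf_left :: "nat \<Rightarrow> nat" where
  "conf_left c = fst (prod_decode (snd (prod_decode c)))"

definition conf_right :: "nat \<Rightarrow> nat" where
  "conf_right c = snd (prod_decode (snd (prod_decode c)))"

definition conf :: "nat \<Rightarrow> nat \<Rightarrow> nat \<Rightarrow> nat" where
  "conf q l r = prod_encode (q, prod_encode (l, r))"

lemma conf_simps [simp]: "conf_state (conf q l r) = q" "conf_left (conf q l r) = l"
  "conf_right (conf q l r) = r"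
  by (simp_all add: conf_def conf_state_def conf_left_def conf_right_def)

section \<open>The universal machine as a total recursive function\<close>

definition u_entry :: "nat \<Rightarrow> nat \<Rightarrow> nat" where
  "u_entry e c = code_nth e (prod_encode (conf_state c, code_hd (conf_right c)))"

definition u_act :: "nat \<Rightarrow> nat \<Rightarrow> nat" where
  "u_act e c = snd (prod_decode (u_entry e c - 1))"

definition u_symbol :: "nat \<Rightarrow> nat \<Rightarrow> nat" where
  "u_symbol e c = fst (prod_decode (u_act e c))"

definition u_move :: "nat \<Rightarrow> nat \<Rightarrow> nat" where
  "u_move e c = fst (prod_decode (snd (prod_decode (u_act e c))))"

text \<open>As in \<open>code_option\<close>, 0 means that no signal is sent and signal
  \<open>x\<close> is shown as \<open>Suc x\<close>; a halted machine is silent.\<close>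

definition u_signal :: "nat \<Rightarrow> nat \<Rightarrow> nat" where
  "u_signal e c = (if u_entry e c = 0 then 0 else snd (prod_decode (snd (prod_decode (u_act e c)))))"

definition u_step :: "nat \<Rightarrow> nat \<Rightarrow> nat" where
  "u_step e c = (if u_entry e c = 0 then c else
     if u_move e c = 0 then conf (fst (prod_decode (u_entry e c - 1))) (code_tl (conf_left c))
       (code_Cons (code_hd (conf_left c)) (code_Cons (u_symbol e c) (code_tl (conf_right c))))
     else if u_move e c = 1 then conf (fst (prod_decode (u_entry e c - 1))) (conf_left c)
       (code_Cons (u_symbol e c) (code_tl (conf_right c)))
     else conf (fst (prod_decode (u_entry e c - 1))) (code_Cons (u_symbol e c) (conf_left c))
       (code_tl (conf_right c)))"

definition u_conf :: "nat \<Rightarrow> nat \<Rightarrow> nat \<Rightarrow> nat" where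
  "u_conf e n t = rec_nat (conf 0 0 (rec_nat 0 (\<lambda>i r. code_Cons 1 r) n)) (\<lambda>i c. u_step e c) t"

definition u_emitted :: "nat \<Rightarrow> nat \<Rightarrow> nat \<Rightarrow> nat" where
  "u_emitted e n t = u_signal e (u_conf e n t)"

lemma computable_u_entry:
  "computable k A \<Longrightarrow> computable k B \<Longrightarrow> computable k (\<lambda>xs. u_entry (A xs) (B xs))"
  unfolding u_entry_def conf_state_def conf_right_def by (intro computable_basic)

lemma computable_u_act:
  "computable k A \<Longrightarrow> computable k B \<Longrightarrow> computable k (\<lambda>xs. u_act (A xs) (B xs))"
  unfolding u_act_def by (intro computable_basic computable_u_entry)

lemma computable_u_signal:
  "computable k A \<Longrightarrow> computable k B \<Longrightarrow> computable k (\<lambda>xs. u_signal (A xs) (B xs))"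
  unfolding u_signal_def by (intro computable_basic computable_u_entry computable_u_act)

lemma computable_u_step:
  "computable k A \<Longrightarrow> computable k B \<Longrightarrow> computable k (\<lambda>xs. u_step (A xs) (B xs))"
  unfolding u_step_def conf_def conf_left_def conf_right_def u_symbol_def u_move_def
  by (intro computable_basic computable_u_entry computable_u_act)

lemma computable_u_emitted:
  assumes "computable k A" "computable k B" "computable k C"
  shows "computable k (\<lambda>xs. u_emitted (A xs) (B xs) (C xs))"
proof -
  have "computable 3 (\<lambda>xs. u_emitted (xs ! 0) (xs ! 1) (xs ! 2))"
    unfolding u_emitted_def u_conf_def conf_def
    by (intro computable_u_signal computable_rec_nat computable_u_step computable_basic) auto
  then show ?thesis by (rule computable_comp3) (rule assms)+
qed

text \<open>A relation rather than a function, since trailing blanks may or may not be listed.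
  Reading past the end of a coded list yields 0, the blank, so finite lists represent the tape,
  which is infinite in both directions.\<close>

definition conf_code :: "config \<Rightarrow> nat \<Rightarrow> bool" where
  "conf_code x c \<longleftrightarrow> (case x of (q, i, tape) \<Rightarrow> conf_state c = q \<and>
     (\<forall>j. code_nth (conf_right c) j = tape (i + int j)) \<and>
     (\<forall>j. code_nth (conf_left c) j = tape (i - 1 - int j)))"

definition valid_config :: "tm \<Rightarrow> config \<Rightarrow> bool" where
  "valid_config P x \<longleftrightarrow> (case x of (q, i, tape) \<Rightarrow> q < states P \<and> (\<forall>j. tape j < symbols P))"

lemma wf_tmD:
  assumes "wf_tm P" "q < states P" "a < symbols P" "delta P q a = Some (q', a', d, e)"
  shows "q' < states P" "a' < symbols P" "e = Some x \<Longrightarrow> x < signals P"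
  using assms unfolding wf_tm_def by blast+

lemma valid_config_step:
  assumes "wf_tm P" "valid_config P x"
  shows "valid_config P (step P x)"
proof -
  obtain q i tape where x: "x = (q, i, tape)" by (metis prod.collapse)
  then have valid: "q < states P" "\<And>j. tape j < symbols P"
    using assms(2) by (auto simp: valid_config_def)
  show ?thesis
  proof (cases "delta P q (tape i)")
    case None
    then show ?thesis using assms(2) by (simp add: x)
  next
    case (Some r)
    obtain q' a d e where r: "r = (q', a, d, e)" by (metis prod.collapse)
    with wf_tmD[OF assms(1) valid(1,2)] Some have "q' < states P" "a < symbols P" by blast+
    then show ?thesis
      using Some valid(2) by (simp add: x r valid_config_def)
  qed
qed

lemma valid_config_run:
  assumes "wf_tm P"
  shows "valid_config P ((step P ^^ t) (init_config n))"
proof (induction t)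
  case 0
  then show ?case
    using assms by (auto simp: valid_config_def init_config_def wf_tm_def)
next
  case (Suc t)
  then show ?case
    using valid_config_step[OF assms] by simp
qed

lemma emitted_at_less_signals:
  assumes "wf_tm P" "emitted_at P n t = Some x"
  shows "x < signals P"
proof -
  obtain q i tape where c: "(step P ^^ t) (init_config n) = (q, i, tape)" by (metis prod.collapse)
  with valid_config_run[OF assms(1), of t n] have "q < states P" "tape i < symbols P"
    by (auto simp: valid_config_def)
  moreover obtain q' a d where "delta P q (tape i) = Some (q', a, d, Some x)"
    using assms(2) c by (auto simp: emitted_at_def split: option.splits)
  ultimately show ?thesis
    using wf_tmD[OF assms(1)] by blast
qed

text \<open>Validity of the configuration keeps the table lookup within the entries that
  \<open>tm_code\<close> prescribes.\<close>

lemma u_simulation_step: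
  assumes P: "tm_code P e" "valid_config P x" and c: "conf_code x c"
  shows "conf_code (step P x) (u_step e c)" "u_signal e c = code_option (emission P x)"
proof -
  obtain q i tape where x: "x = (q, i, tape)" by (metis prod.collapse)
  have q: "conf_state c = q"
    and right: "code_nth (conf_right c) j = tape (i + int j)"
    and left: "code_nth (conf_left c) j = tape (i - 1 - int j)" for j
    using c by (auto simp: conf_code_def x)
  have hd_right: "code_hd (conf_right c) = tape i" and hd_left: "code_hd (conf_left c) = tape (i - 1)"
    using right[of 0] left[of 0] by (auto simp: code_nth_zero)
  have tl_right: "code_nth (code_tl (conf_right c)) j = tape (i + 1 + int j)"
    and tl_left: "code_nth (code_tl (conf_left c)) j = tape (i - 2 - int j)" for j
    using right[of "Suc j"] left[of "Suc j"] by (auto simp: code_nth_tl algebra_simps)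
  have entry: "u_entry e c = code_trans (delta P q (tape i))"
    using P q hd_right by (auto simp: u_entry_def tm_code_def valid_config_def x)
  have "conf_code (step P x) (u_step e c) \<and> u_signal e c = code_option (emission P x)"
  proof (cases "delta P q (tape i)")
    case None
    then show ?thesis
      using entry c by (simp add: u_step_def u_signal_def x)
  next
    case (Some r)
    obtain q' a d y where r: "r = (q', a, d, y)" by (metis prod.collapse)
    show ?thesis
    proof (cases d)
      case MLeft
      then show ?thesis
        using entry Some r tl_right tl_left hd_left
        by (auto simp: add.assoc u_step_def u_signal_def x u_move_def u_act_def u_symbol_def conf_code_def
            code_nth_Cons split: nat.split)
    next
      case MStay
      then show ?thesis
        using entry Some r tl_right left
        by (auto simp: add.assoc u_step_def u_signal_def x u_move_def u_act_def u_symbol_def conf_code_def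
            code_nth_Cons split: nat.split)
    next
      case MRight
      then show ?thesis
        using entry Some r tl_right left
        by (auto simp: algebra_simps u_step_def u_signal_def x u_move_def u_act_def u_symbol_def conf_code_def
            code_nth_Cons split: nat.split)
    qed
  qed
  then show "conf_code (step P x) (u_step e c)" "u_signal e c = code_option (emission P x)"
    by auto
qed

lemma conf_code_init: "conf_code (init_config n) (conf 0 0 (rec_nat 0 (\<lambda>i r. code_Cons 1 r) n))"
proof -
  have "code_nth (rec_nat 0 (\<lambda>i r. code_Cons 1 r) n) j = (if j < n then 1 else 0)" for j
    by (induction n arbitrary: j) (auto simp: code_nth_Cons split: nat.split)
  then show ?thesis
    by (auto simp: conf_code_def init_config_def)
qed

lemma u_emitted_eq:
  assumes "wf_tm P" "tm_code P e"
  shows "u_emitted e n t = code_option (emitted_at P n t)"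
proof -
  have "conf_code ((step P ^^ t) (init_config n)) (u_conf e n t)"
  proof (induction t)
    case 0
    then show ?case
      using conf_code_init[of n] by (simp add: u_conf_def)
  next
    case (Suc t)
    then show ?case
      using u_simulation_step(1)[OF assms(2) valid_config_run[OF assms(1)]] by (simp add: u_conf_def)
  qed
  then show ?thesis
    unfolding u_emitted_def emitted_at_def
    by (intro u_simulation_step assms valid_config_run)
qed

section \<open>The word of signals emitted so far\<close>

definition emitted_before :: "tm \<Rightarrow> nat \<Rightarrow> nat \<Rightarrow> nat list" where
  "emitted_before P n t =
    map (\<lambda>u. the (emitted_at P n u)) (filter (\<lambda>u. emitted_at P n u \<noteq> None) [0..<t])"

lemma emitted_before_eventually:
  assumes "finite (emission_times P n)"
  shows "eventually (\<lambda>t. emitted_before P n t = emitted P n) sequentially"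
proof -
  obtain T where T: "emission_times P n \<subseteq> {..<T}"
    using assms finite_nat_iff_bounded by blast
  have "emitted_before P n t = emitted P n" if "t \<ge> T" for t
  proof -
    let ?us = "filter (\<lambda>u. emitted_at P n u \<noteq> None) [0..<t]"
    have set: "set ?us = emission_times P n"
      using T that by (auto simp: emission_times_def)
    have "?us = sorted_list_of_set (emission_times P n)"
    proof (rule sorted_distinct_set_unique)
      show "sorted ?us" "distinct ?us"
        by (simp_all add: sorted_wrt_filter)
    qed (simp_all only: set sorted_sorted_list_of_set distinct_sorted_list_of_set
        set_sorted_list_of_set[OF assms])
    then show ?thesis
      by (simp add: emitted_before_def emitted_def)
  qed
  then show ?thesis by (auto simp: eventually_sequentially)
qed

lemma length_emitted: "length (emitted P n) = card (emission_times P n)"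
  by (simp add: emitted_def)

lemma emitted_lists:
  assumes "wf_tm P" "finite (emission_times P n)"
  shows "emitted P n \<in> lists {..<signals P}"
  using assms emitted_at_less_signals[OF assms(1)]
  by (auto simp: emitted_def emission_times_def)

text \<open>\<open>code_Cons\<close> adds in front, so the times are visited backwards from
  \<open>t - 1\<close> to 0. The subtraction of 1 undoes the successor in
  \<open>code_option\<close>.\<close>

definition u_word :: "nat \<Rightarrow> nat \<Rightarrow> nat \<Rightarrow> nat" where
  "u_word e n t = rec_nat 0 (\<lambda>k w. if u_emitted e n (t - Suc k) = 0 then w
     else code_Cons (u_emitted e n (t - Suc k) - 1) w) t"

lemma computable_u_word:
  assumes "computable k A" "computable k B" "computable k C"
  shows "computable k (\<lambda>xs. u_word (A xs) (B xs) (C xs))"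
proof -
  have "computable 3 (\<lambda>xs. u_word (xs ! 0) (xs ! 1) (xs ! 2))"
    unfolding u_word_def
    by (intro computable_rec_nat computable_basic computable_u_emitted) auto
  then show ?thesis by (rule computable_comp3) (rule assms)+
qed

lemma u_word_eq:
  assumes "wf_tm P" "tm_code P e"
  shows "u_word e n t = list_encode (emitted_before P n t)"
proof -
  let ?w = "\<lambda>k. rec_nat 0 (\<lambda>k w. if u_emitted e n (t - Suc k) = 0 then w
     else code_Cons (u_emitted e n (t - Suc k) - 1) w) k"
  have "?w k = list_encode (map (\<lambda>u. the (emitted_at P n u))
      (filter (\<lambda>u. emitted_at P n u \<noteq> None) [t - k..<t]))" if "k \<le> t" for k
    using that
  proof (induction k)
    case (Suc k)
    then have "[t - Suc k..<t] = (t - Suc k) # [t - k..<t]"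
      by (simp add: upt_conv_Cons Suc_diff_Suc)
    then show ?case
      using Suc u_emitted_eq[OF assms, of n "t - Suc k"]
      by (cases "emitted_at P n (t - Suc k)") (auto simp: list_encode_code_Cons simp del: list_encode.simps(2))
  qed simp
  from this[of t] show ?thesis
    by (simp add: u_word_def emitted_before_def)
qed

section \<open>The limit lemma: \<open>\<Delta>\<^sub>2\<close> sets and recursive
  approximations\<close>

lemma computable_char_rels:
  assumes "computable k f"
  shows "{xs \<in> tuples k. f xs \<noteq> 0} \<in> recursive_rels k"
proof -
  have "computable k (\<lambda>xs. if f xs = 0 then 0 else 1)"
    by (intro computable_basic assms)
  then obtain g where "recursive k g" "\<And>xs. length xs = k \<Longrightarrow> g xs = (if f xs = 0 then 0 else 1)"
    unfolding computable_def by blast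
  then show ?thesis
    unfolding recursive_rels_def by (auto simp: tuples_def)
qed

text \<open>A \<open>\<Pi>\<^sub>1\<close> relation is the complement of a projection, so the inner
  quantifier says that no \<open>c\<close> lands in the recursive matrix, of which \<open>q\<close>
  is the characteristic function. The innermost variable comes first because each projection removes
  the head of the list.\<close>

lemma Sigma2_iff:
  "(\<lambda>n. [n]) ` R \<in> Sigma_rels 2 1 \<longleftrightarrow>
    (\<exists>q. computable 3 q \<and> (\<forall>n. n \<in> R \<longleftrightarrow> (\<exists>b. \<forall>c. q [c, b, n] = 0)))"
proof
  assume "(\<lambda>n. [n]) ` R \<in> Sigma_rels 2 1"
  then obtain Q where Q: "Q \<in> recursive_rels 3" and
    R: "(\<lambda>n. [n]) ` R = {as \<in> tuples 1. \<exists>b. b # as \<in> tuples 2 - {as \<in> tuples 2. \<exists>c. c # as \<in> Q}}"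
    by (auto simp: numeral_2_eq_2 numeral_3_eq_3)
  obtain f where f: "recursive 3 f" "\<And>xs. xs \<in> tuples 3 \<Longrightarrow> f xs = (if xs \<in> Q then 1 else 0)"
    using Q by (auto simp: recursive_rels_def)
  have "n \<in> R \<longleftrightarrow> (\<exists>b. \<forall>c. f [c, b, n] = 0)" for n
  proof -
    have "n \<in> R \<longleftrightarrow> [n] \<in> (\<lambda>n. [n]) ` R" by auto
    also have "\<dots> \<longleftrightarrow> (\<exists>b. \<forall>c. [c, b, n] \<notin> Q)"
      unfolding R by (auto simp: tuples_def)
    also have "\<dots> \<longleftrightarrow> (\<exists>b. \<forall>c. f [c, b, n] = 0)"
      using f(2) by (simp add: tuples_def)
    finally show ?thesis .
  qed
  then show "\<exists>q. computable 3 q \<and> (\<forall>n. n \<in> R \<longleftrightarrow> (\<exists>b. \<forall>c. q [c, b, n] = 0))"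
    using f(1) computable_recursive by blast
next
  assume "\<exists>q. computable 3 q \<and> (\<forall>n. n \<in> R \<longleftrightarrow> (\<exists>b. \<forall>c. q [c, b, n] = 0))"
  then obtain q where q: "computable 3 q" "\<And>n. n \<in> R \<longleftrightarrow> (\<exists>b. \<forall>c. q [c, b, n] = 0)"
    by blast
  let ?Q = "{xs \<in> tuples 3. q xs \<noteq> 0}"
  let ?P = "tuples 2 - {as \<in> tuples 2. \<exists>c. c # as \<in> ?Q}"
  have "?Q \<in> recursive_rels (Suc (Suc (Suc 0)))"
    using computable_char_rels[OF q(1)] by (simp add: numeral_3_eq_3)
  then have "?P \<in> Pi_rels 1 2"
    unfolding numeral_2_eq_2 One_nat_def Pi_rels.simps by blast
  moreover have "(\<lambda>n. [n]) ` R = {as \<in> tuples 1. \<exists>b. b # as \<in> ?P}"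
  proof (intro set_eqI iffI)
    fix as assume "as \<in> (\<lambda>n. [n]) ` R"
    then show "as \<in> {as \<in> tuples 1. \<exists>b. b # as \<in> ?P}"
      using q(2) by (auto simp: tuples_def)
  next
    fix as assume as: "as \<in> {as \<in> tuples 1. \<exists>b. b # as \<in> ?P}"
    then obtain n where "as = [n]"
      by (auto simp: tuples_def length_Suc_conv)
    then show "as \<in> (\<lambda>n. [n]) ` R"
      using q(2) as by (auto simp: tuples_def)
  qed
  ultimately show "(\<lambda>n. [n]) ` R \<in> Sigma_rels 2 1"
    unfolding numeral_2_eq_2 One_nat_def Sigma_rels.simps by blast
qed

lemma Delta2_iff:
  "R \<in> Delta2 \<longleftrightarrow> (\<lambda>n. [n]) ` R \<in> Sigma_rels 2 1 \<and> (\<lambda>n. [n]) ` (- R) \<in> Sigma_rels 2 1"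
proof -
  have Sigma_sub: "S \<subseteq> tuples 1" if "S \<in> Sigma_rels 2 1" for S
    using that by (auto simp: numeral_2_eq_2)
  have tuples: "tuples 1 = range (\<lambda>n. [n])"
    by (auto simp: tuples_def length_Suc_conv)
  have compl: "tuples 1 - (\<lambda>n. [n]) ` R = (\<lambda>n. [n]) ` (- R)"
    unfolding tuples by auto
  have Pi: "(\<lambda>n. [n]) ` R \<in> Pi_rels 2 1 \<longleftrightarrow> (\<lambda>n. [n]) ` (- R) \<in> Sigma_rels 2 1"
  proof
    assume "(\<lambda>n. [n]) ` R \<in> Pi_rels 2 1"
    then obtain S where S: "S \<in> Sigma_rels 2 1" "(\<lambda>n. [n]) ` R = tuples 1 - S"
      using Pi_rels_Suc[of 1 1] by (auto simp: numeral_2_eq_2)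
    then have "S = (\<lambda>n. [n]) ` (- R)"
      using compl Sigma_sub[OF S(1)] by (simp add: double_diff)
    with S show "(\<lambda>n. [n]) ` (- R) \<in> Sigma_rels 2 1" by simp
  next
    assume "(\<lambda>n. [n]) ` (- R) \<in> Sigma_rels 2 1"
    moreover have "(\<lambda>n. [n]) ` R = tuples 1 - (\<lambda>n. [n]) ` (- R)"
      unfolding tuples by auto
    ultimately show "(\<lambda>n. [n]) ` R \<in> Pi_rels 2 1"
      using Pi_rels_Suc[of 1 1] by (auto simp: numeral_2_eq_2)
  qed
  show ?thesis
    unfolding Delta2_def Delta_rels_def by (simp only: mem_Collect_eq Int_iff Pi)
qed

text \<open>The bound by 1 makes the current value recoverable from the parity of the number of
  changes.\<close>

definition limit_computes :: "(nat list \<Rightarrow> nat) \<Rightarrow> nat set \<Rightarrow> bool" where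
  "limit_computes h R \<longleftrightarrow> computable 2 h \<and> (\<forall>t n. h [t, n] \<le> 1) \<and>
     (\<forall>n. eventually (\<lambda>t. h [t, n] = of_bool (n \<in> R)) sequentially)"

lemma computable_comp2_list:
  assumes "computable 2 h" "computable k A" "computable k B"
  shows "computable k (\<lambda>xs. h [A xs, B xs])"
  using computable_comp[of "[A, B]" h k] assms by (auto simp: numeral_2_eq_2)

lemma computable_comp3_list:
  assumes "computable 3 h" "computable k A" "computable k B" "computable k C"
  shows "computable k (\<lambda>xs. h [A xs, B xs, C xs])"
  using computable_comp[of "[A, B, C]" h k] assms by (auto simp: numeral_3_eq_3)

text \<open>The defining formula says that from some stage \<open>b\<close> on the value is
  \<open>v\<close>. The parameter \<open>v\<close> serves both sides: 1 for the set and 0 for its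
  complement.\<close>

lemma Sigma2_of_limit:
  assumes h: "computable 2 h" "\<And>n. eventually (\<lambda>t. h [t, n] = v \<longleftrightarrow> n \<in> R) sequentially"
  shows "(\<lambda>n. [n]) ` R \<in> Sigma_rels 2 1"
  unfolding Sigma2_iff
proof (intro exI conjI allI)
  show "computable 3 (\<lambda>xs. if h [xs ! 1 + xs ! 0, xs ! 2] = v then 0 else 1)"
    by (intro computable_comp2_list[OF h(1)] computable_basic) auto
  fix n
  obtain T where T: "\<And>t. t \<ge> T \<Longrightarrow> h [t, n] = v \<longleftrightarrow> n \<in> R"
    using h(2)[of n] by (auto simp: eventually_sequentially)
  have "n \<in> R \<longleftrightarrow> (\<exists>b. \<forall>c. h [b + c, n] = v)"
    using T by (metis le_add1 le_add2)
  then show "n \<in> R \<longleftrightarrow> (\<exists>b. \<forall>c. (if h [[c, b, n] ! 1 + [c, b, n] ! 0, [c, b, n] ! 2] = v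
      then 0 else 1) = (0::nat))"
    by simp
qed

lemma eventually_const_of_bounded_mono:
  fixes f :: "nat \<Rightarrow> nat"
  assumes "mono f" "\<And>t. f t \<le> B"
  shows "\<exists>N. eventually (\<lambda>t. f t = N) sequentially"
proof -
  have fin: "finite (range f)"
    by (rule finite_subset[of _ "{..B}"]) (use assms(2) in auto)
  then obtain T where T: "f T = Max (range f)"
    using Max_in[of "range f"] by (metis empty_iff imageE rangeI)
  have "f t = f T" if "t \<ge> T" for t
    using that monoD[OF assms(1) that] Max_ge[OF fin, of "f t"] T by simp
  then show ?thesis by (auto simp: eventually_sequentially)
qed

text \<open>Candidates \<open>(side, b)\<close> for a true instance of one of the two \<open>\<Sigma>\<^sub>2\<close> definitions are tried in
  turn; the next one is taken when the current one is refuted.\<close>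

lemma limit_of_Delta2:
  assumes "R \<in> Delta2"
  shows "\<exists>h. limit_computes h R"
proof -
  obtain p q where p: "computable 3 p" "\<And>n. n \<in> R \<longleftrightarrow> (\<exists>b. \<forall>c. p [c, b, n] = 0)"
    and q: "computable 3 q" "\<And>n. n \<notin> R \<longleftrightarrow> (\<exists>b. \<forall>c. q [c, b, n] = 0)"
    using assms unfolding Delta2_iff Sigma2_iff by auto
  define r where "r c j n = (if fst (prod_decode j) = 0 then p [c, snd (prod_decode j), n]
    else q [c, snd (prod_decode j), n])" for c j n
  define J where "J t n = rec_nat 0 (\<lambda>i j. if (\<Sum>c<i. r c j n) = 0 then j else Suc j) t" for t n
  have r: "computable k A \<Longrightarrow> computable k B \<Longrightarrow> computable k C \<Longrightarrow>
      computable k (\<lambda>xs. r (A xs) (B xs) (C xs))" for k A B C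
    unfolding r_def by (intro computable_basic computable_comp3_list[OF p(1)] computable_comp3_list[OF q(1)])
  have "computable 2 (\<lambda>xs. J (xs ! 0) (xs ! 1))"
    unfolding J_def by (intro computable_rec_nat computable_basic computable_sum r) (auto intro: computable_drop_nth)
  then have "computable 2 (\<lambda>xs. if fst (prod_decode (J (xs ! 0) (xs ! 1))) = 0 then 1 else 0)"
    by (intro computable_basic)
  moreover have "eventually (\<lambda>t. (if fst (prod_decode (J t n)) = 0 then 1 else 0) = (of_bool (n \<in> R) :: nat))
      sequentially" for n
  proof -
    have J_Suc: "J (Suc t) n = (if (\<Sum>c<t. r c (J t n) n) = 0 then J t n else Suc (J t n))" for t
      by (simp add: J_def)
    \<comment> \<open>Any candidate that is never refuted, on whichever side, gives the right
      answer, because the two definitions describe complementary sets. So it does not matter which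
      one the search settles on.\<close>
    have valid: "fst (prod_decode j) = 0 \<longleftrightarrow> n \<in> R" if "\<And>c. r c j n = 0" for j
    proof (cases "fst (prod_decode j) = 0")
      case True
      then have "\<forall>c. p [c, snd (prod_decode j), n] = 0" using that by (simp add: r_def)
      with p(2) True show ?thesis by blast
    next
      case False
      then have "\<forall>c. q [c, snd (prod_decode j), n] = 0" using that by (simp add: r_def)
      with q(2) False show ?thesis by blast
    qed
    have "\<exists>j. \<forall>c. r c j n = 0"
    proof (cases "n \<in> R")
      case True
      then obtain b where "\<forall>c. p [c, b, n] = 0" using p by blast
      then show ?thesis by (intro exI[of _ "prod_encode (0, b)"]) (simp add: r_def)
    next
      case False
      then obtain b where "\<forall>c. q [c, b, n] = 0" using q by blast
      then show ?thesis by (intro exI[of _ "prod_encode (1, b)"]) (simp add: r_def)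
    qed
    then obtain j0 where j0: "\<And>c. r c j0 n = 0" by blast
    \<comment> \<open>A true candidate is never refuted, so the search cannot move past
      \<open>j0\<close>.\<close>
    have "J t n \<le> j0" for t
    proof (induction t)
      case (Suc t)
      then show ?case using j0 by (cases "J t n = j0") (auto simp: J_Suc)
    qed (simp add: J_def)
    moreover have "mono (\<lambda>t. J t n)"
      by (auto simp: mono_iff_le_Suc J_Suc)
    ultimately obtain j where "eventually (\<lambda>t. J t n = j) sequentially"
      using eventually_const_of_bounded_mono by blast
    then obtain T where T: "\<And>t. t \<ge> T \<Longrightarrow> J t n = j"
      by (auto simp: eventually_sequentially)
    \<comment> \<open>A stage beyond both \<open>T\<close> and \<open>c\<close> tests instance
      \<open>c\<close> of the limit candidate and still keeps the candidate.\<close>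
    have "r c j n = 0" for c
    proof -
      have "J (Suc (max T (Suc c))) n = J (max T (Suc c)) n"
        using T by simp
      then have "(\<Sum>c<max T (Suc c). r c j n) = 0"
        using T[of "max T (Suc c)"] by (auto simp: J_Suc split: if_splits)
      then show ?thesis by simp
    qed
    from valid[OF this] show ?thesis
      unfolding eventually_sequentially by (intro exI[of _ T]) (simp add: T)
  qed
  ultimately have "limit_computes (\<lambda>xs. if fst (prod_decode (J (xs ! 0) (xs ! 1))) = 0 then 1 else 0) R"
    by (auto simp: limit_computes_def)
  then show ?thesis by blast
qed

lemma Delta2_of_limit:
  assumes "limit_computes h R"
  shows "R \<in> Delta2"
  unfolding Delta2_iff
proof
  have h: "computable 2 h" "eventually (\<lambda>t. h [t, n] = of_bool (n \<in> R)) sequentially" for n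
    using assms by (auto simp: limit_computes_def)
  have "eventually (\<lambda>t. h [t, n] = 1 \<longleftrightarrow> n \<in> R) sequentially" for n
    using h(2)[of n] by (rule eventually_mono) auto
  then show "(\<lambda>n. [n]) ` R \<in> Sigma_rels 2 1"
    by (rule Sigma2_of_limit[OF h(1)])
  have "eventually (\<lambda>t. h [t, n] = 0 \<longleftrightarrow> n \<in> - R) sequentially" for n
    using h(2)[of n] by (rule eventually_mono) auto
  then show "(\<lambda>n. [n]) ` (- R) \<in> Sigma_rels 2 1"
    by (rule Sigma2_of_limit[OF h(1)])
qed

section \<open>Signal classes\<close>

lemma signal_class_limit:
  assumes "R \<in> signal_class timelike \<gamma>1 \<gamma>2 T b"
  obtains h where "limit_computes h R"
    "\<And>n. finite {t. h [Suc t, n] \<noteq> h [t, n]}" "\<And>n. enat (card {t. h [Suc t, n] \<noteq> h [t, n]}) \<le> b"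
proof -
  obtain P D where P: "wf_tm P" and D: "recursive_decision (signals P) D"
    and fin: "\<And>n. finite (emission_times P n)" and len: "\<And>n. enat (length (emitted P n)) \<le> b"
    and R: "\<And>n. n \<in> R \<longleftrightarrow> D n (emitted P n) = 1"
    using assms unfolding signal_class_def by blast
  obtain f where f: "recursive 2 f" "\<And>n s. s \<in> lists {..<signals P} \<Longrightarrow> f [n, list_encode s] = D n s"
    and D01: "\<And>n s. s \<in> lists {..<signals P} \<Longrightarrow> D n s \<in> {0, 1}"
    using D unfolding recursive_decision_def by blast
  obtain e where e: "tm_code P e"
    using ex_tm_code by blast
  \<comment> \<open>Testing for the value 1 makes \<open>h\<close> 0-1 valued at once, whatever
    \<open>f\<close> returns on the words met along the way; only the final word has to be shown to
    lie over the signal alphabet.\<close>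
  define h where "h xs = (if f [xs ! 1, u_word e (xs ! 1) (xs ! 0)] = 1 then 1 else 0 :: nat)" for xs
  have h: "h [t, n] = of_bool (f [n, list_encode (emitted_before P n t)] = 1)" for t n
    using u_word_eq[OF P e] by (simp add: h_def)
  have "computable 2 h"
    unfolding h_def
    by (intro computable_basic computable_comp2_list[OF computable_recursive[OF f(1)]] computable_u_word) auto
  moreover have "eventually (\<lambda>t. h [t, n] = of_bool (n \<in> R)) sequentially" for n
    using emitted_before_eventually[OF fin[of n]]
  proof (rule eventually_mono)
    fix t assume "emitted_before P n t = emitted P n"
    then show "h [t, n] = of_bool (n \<in> R)"
      using f(2)[OF emitted_lists[OF P fin]] R by (simp add: h)
  qed
  ultimately have lim: "limit_computes h R"
    by (simp add: limit_computes_def h)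
  have sub: "{t. h [Suc t, n] \<noteq> h [t, n]} \<subseteq> emission_times P n" for n
  proof
    fix t assume t: "t \<in> {t. h [Suc t, n] \<noteq> h [t, n]}"
    then have "emitted_before P n (Suc t) \<noteq> emitted_before P n t"
      by (auto simp: h)
    then show "t \<in> emission_times P n"
      by (cases "emitted_at P n t") (auto simp: emitted_before_def emission_times_def)
  qed
  show thesis
  proof (rule that[OF lim])
    fix n
    show "finite {t. h [Suc t, n] \<noteq> h [t, n]}"
      using sub fin finite_subset by blast
    have "card {t. h [Suc t, n] \<noteq> h [t, n]} \<le> length (emitted P n)"
      unfolding length_emitted by (rule card_mono[OF fin sub])
    then show "enat (card {t. h [Suc t, n] \<noteq> h [t, n]}) \<le> b"
      using len[of n] by (meson enat_ord_simps(1) order_trans)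
  qed
qed

text \<open>The machine signals whenever the approximation changes, starting from 0, so that the parity of
  the number of signals is the limit.\<close>

lemma parity_tm:
  assumes "limit_computes h R"
  obtains P where "wf_tm P" "signals P = 1" "\<And>n. finite (emission_times P n)"
    "\<And>n. odd (card (emission_times P n)) \<longleftrightarrow> n \<in> R"
    "\<And>n. finite {t. h [Suc t, n] \<noteq> h [t, n]} \<Longrightarrow>
      card (emission_times P n) \<le> Suc (card {t. h [Suc t, n] \<noteq> h [t, n]})"
proof -
  have h: "computable 2 h" "\<And>t n. h [t, n] \<le> 1"
    "\<And>n. eventually (\<lambda>t. h [t, n] = of_bool (n \<in> R)) sequentially"
    using assms by (auto simp: limit_computes_def)
  have h01: "h [t, n] = 0 \<or> h [t, n] = 1" for t n
    using h(2)[of t n] by linarith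
  define g where "g xs = (if xs ! 0 = 0 then h [0, xs ! 1]
    else if h [xs ! 0, xs ! 1] = h [xs ! 0 - 1, xs ! 1] then 0 else 1)" for xs
  have g: "computable 2 g"
    unfolding g_def by (intro computable_basic computable_comp2_list[OF h(1)]) auto
  let ?S = "\<lambda>t n. \<Sum>u<Suc t. g [u, n]"
  have parity: "odd (?S t n) \<longleftrightarrow> h [t, n] = 1" for t n
  proof (induction t)
    case 0
    then show ?case using h01[of 0 n] by (auto simp: g_def)
  next
    case (Suc t)
    have "?S (Suc t) n = ?S t n + (if h [Suc t, n] = h [t, n] then 0 else 1)"
      by (subst sum.lessThan_Suc) (simp add: g_def)
    then show ?case
      using Suc h01[of t n] h01[of "Suc t" n] by (simp only: odd_add) auto
  qed
  \<comment> \<open>The successor pays for the signal at stage 0 that is sent when the approximation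
    starts at 1.\<close>
  have bound: "?S t n \<le> Suc (card {t. h [Suc t, n] \<noteq> h [t, n]})"
    if "finite {t. h [Suc t, n] \<noteq> h [t, n]}" for t n
  proof -
    have "?S t n = h [0, n] + (\<Sum>u<t. g [Suc u, n])"
      by (subst sum.lessThan_Suc_shift) (simp add: g_def)
    also have "(\<Sum>u<t. g [Suc u, n]) = card {u \<in> {..<t}. h [Suc u, n] \<noteq> h [u, n]}"
      by (simp add: g_def sum.If_cases Int_def)
    also have "\<dots> \<le> card {t. h [Suc t, n] \<noteq> h [t, n]}"
      by (rule card_mono[OF that]) auto
    finally show ?thesis using h(2)[of 0 n] by linarith
  qed
  obtain P where P: "wf_tm P" "signals P = 1"
    and emit: "\<And>n N. eventually (\<lambda>t. (\<Sum>u<t. g [u, n]) = N) sequentially \<Longrightarrow>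
      finite (emission_times P n) \<and> card (emission_times P n) = N"
    using tm_of_computable[OF g] by blast
  have lim: "\<exists>t. h [t, n] = of_bool (n \<in> R) \<and> finite (emission_times P n) \<and>
      card (emission_times P n) = ?S t n" for n
  proof -
    obtain T where T: "\<And>t. t \<ge> T \<Longrightarrow> h [t, n] = of_bool (n \<in> R)"
      using h(3)[of n] by (auto simp: eventually_sequentially)
    \<comment> \<open>The sum is constant only from \<open>Suc T\<close> on: \<open>g\<close>
      compares a stage with its predecessor, and both have to be at least \<open>T\<close>.\<close>
    have "(\<Sum>u<t. g [u, n]) = ?S T n" if "t \<ge> Suc T" for t
      using that
    proof (induction t rule: dec_induct)
      case (step m)
      then have "g [m, n] = 0"
        using T[of m] T[of "m - 1"] by (auto simp: g_def)
      with step show ?case by simp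
    qed simp
    then have "eventually (\<lambda>t. (\<Sum>u<t. g [u, n]) = ?S T n) sequentially"
      by (auto simp: eventually_sequentially)
    from emit[OF this] T[of T] show ?thesis by blast
  qed
  show thesis
  proof (rule that[OF P])
    fix n
    obtain t where t: "h [t, n] = of_bool (n \<in> R)" "finite (emission_times P n)"
      "card (emission_times P n) = ?S t n"
      using lim[of n] by blast
    show "finite (emission_times P n)" by (rule t(2))
    show "odd (card (emission_times P n)) \<longleftrightarrow> n \<in> R"
      unfolding t(3) parity using t(1) by simp
    show "card (emission_times P n) \<le> Suc (card {t. h [Suc t, n] \<noteq> h [t, n]})"
      if "finite {t. h [Suc t, n] \<noteq> h [t, n]}"
      unfolding t(3) by (rule bound[OF that])
  qed
qed

text \<open>Over a one-letter alphabet a word is a block of zeros, and its code \<open>E k\<close>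
  grows strictly with its length \<open>k\<close>. So the length is found by minimisation over
  \<open>k\<close>, and its parity by repeated flipping.\<close>

lemma recursive_decision_parity: "recursive_decision 1 (\<lambda>n s. length s mod 2)"
proof -
  define E where "E k = rec_nat 0 (\<lambda>i r. code_Cons 0 r) k" for k :: nat
  have E_Suc: "E (Suc k) = code_Cons 0 (E k)" and E_0: "E 0 = 0" for k
    by (simp_all add: E_def)
  have E: "E k = list_encode (replicate k 0)" for k
    by (induction k) (auto simp: E_0 E_Suc list_encode_code_Cons simp del: list_encode.simps(2))
  have "E k < E (Suc k)" for k
    using le_prod_encode_2[of "E k" 0] by (simp add: E_Suc code_Cons_def)
  then have mono: "strict_mono E" by (simp add: strict_mono_Suc_iff)
  have L: "(LEAST k. E l - E k = 0) = l" for l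
    by (rule Least_equality) (use mono in \<open>auto simp: strict_mono_less_eq\<close>)
  have "computable 1 (\<lambda>xs. LEAST k. xs ! 0 - E k = 0)"
  proof (rule computable_Least)
    show "computable (Suc 1) (\<lambda>ys. drop 1 ys ! 0 - E (ys ! 0))"
      unfolding E_def by (intro computable_basic computable_rec_nat) auto
    show "\<exists>k. xs ! 0 - E k = 0" for xs :: "nat list"
      using strict_mono_imp_increasing[OF mono, of "xs ! 0"] by (metis diff_is_0_eq)
  qed
  then have len: "computable k A \<Longrightarrow> computable k (\<lambda>xs. LEAST k. A xs - E k = 0)" for k A
    by (rule computable_comp1)
  have "computable 2 (\<lambda>xs. rec_nat 0 (\<lambda>i r. 1 - r) (LEAST k. xs ! 1 - E k = 0))"
    by (intro computable_rec_nat computable_basic len) auto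
  then obtain f where f: "recursive 2 f"
    "\<And>xs. length xs = 2 \<Longrightarrow> f xs = rec_nat 0 (\<lambda>i r. 1 - r) (LEAST k. xs ! 1 - E k = 0)"
    unfolding computable_def by blast
  have mod2: "rec_nat 0 (\<lambda>i r. 1 - r) l = l mod (2::nat)" for l :: nat
    by (induction l) (auto simp: mod_Suc)
  have "f [n, list_encode s] = length s mod 2" if "s \<in> lists {..<1}" for n s
  proof -
    have "s = replicate (length s) 0"
      using that by (intro replicate_eqI) auto
    then have eq: "list_encode s = E (length s)"
      unfolding E by simp
    have "f [n, list_encode s] = rec_nat 0 (\<lambda>i r. 1 - r) (LEAST k. list_encode s - E k = 0)"
      using f(2)[of "[n, list_encode s]"] by simp
    then show ?thesis
      unfolding eq L mod2 .
  qed
  then show ?thesis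
    unfolding recursive_decision_def using f(1) by auto
qed

lemma Delta2_signal_class:
  assumes "malament_hogarth timelike \<gamma>1 \<gamma>2 T p" "R \<in> Delta2"
  shows "R \<in> signal_class timelike \<gamma>1 \<gamma>2 T \<infinity>"
proof -
  interpret malament_hogarth timelike \<gamma>1 \<gamma>2 T p by fact
  have receivable: "receivable timelike \<gamma>2 T (\<gamma>1 (real t))" for t
  proof -
    have "\<gamma>1 (real t) \<in> chron_past timelike p"
      using \<gamma>1_past by auto
    then show ?thesis
      using timelike_less[OF \<gamma>2_timelike] \<gamma>2_end
      by (auto simp: receivable_def chron_past_def intro!: bexI[of _ T])
  qed
  obtain h where "limit_computes h R"
    using limit_of_Delta2[OF assms(2)] by blast
  then obtain P where P: "wf_tm P" "signals P = 1" "\<And>n. finite (emission_times P n)"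
    "\<And>n. odd (card (emission_times P n)) \<longleftrightarrow> n \<in> R"
    using parity_tm by metis
  show ?thesis
    unfolding signal_class_def
    using P receivable recursive_decision_parity
    by (auto simp: length_emitted odd_iff_mod_2_eq_one
        intro!: exI[of _ P] exI[of _ "\<lambda>n s. length s mod 2"])
qed

lemma signal_class_Delta2: "signal_class timelike \<gamma>1 \<gamma>2 T b \<subseteq> Delta2"
  using Delta2_of_limit signal_class_limit by (metis subsetI)

text \<open>By \<open>signal_class_limit\<close> and \<open>parity_tm\<close>, a set decided with at most \<open>m\<close> signals is the parity of
  the number of signals of a machine that sends at most \<open>Suc m\<close>. Capping the count there keeps
  \<open>diag\<close> limit computable even for numbers \<open>e\<close> whose machine sends infinitely many signals.\<close>

definition diag_count :: "nat \<Rightarrow> nat \<Rightarrow> nat \<Rightarrow> nat" where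
  "diag_count m e t = min (Suc m) (\<Sum>u<t. if u_emitted e e u = 0 then 0 else 1)"

definition diag :: "nat \<Rightarrow> nat set" where
  "diag m = {e. eventually (\<lambda>t. even (diag_count m e t)) sequentially}"

lemma diag_count_eventually: "\<exists>N. eventually (\<lambda>t. diag_count m e t = N) sequentially"
proof (rule eventually_const_of_bounded_mono)
  show "mono (diag_count m e)"
    by (auto simp: mono_iff_le_Suc diag_count_def)
  show "diag_count m e t \<le> Suc m" for t
    by (simp add: diag_count_def)
qed

text \<open>Since the count settles on \<open>N\<close>, being eventually even is decided by
  \<open>N\<close>; an odd \<open>N\<close> excludes it.\<close>

lemma diag_iff:
  assumes "eventually (\<lambda>t. diag_count m e t = N) sequentially"
  shows "e \<in> diag m \<longleftrightarrow> even N"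
proof -
  obtain T where T: "\<And>t. t \<ge> T \<Longrightarrow> diag_count m e t = N"
    using assms by (auto simp: eventually_sequentially)
  have "e \<in> diag m \<longleftrightarrow> (\<exists>S. \<forall>t\<ge>S. even (diag_count m e t))"
    by (simp add: diag_def eventually_sequentially)
  also have "\<dots> \<longleftrightarrow> even N"
    using T by (metis nat_le_linear)
  finally show ?thesis .
qed

lemma diag_Delta2: "diag m \<in> Delta2"
proof (rule Delta2_of_limit)
  let ?h = "\<lambda>xs. rec_nat 1 (\<lambda>i r. 1 - r) (diag_count m (xs ! 1) (xs ! 0)) :: nat"
  have h: "rec_nat 1 (\<lambda>i r. 1 - r) l = (of_bool (even l) :: nat)" for l :: nat
    by (induction l) auto
  have "computable 2 ?h"
    unfolding diag_count_def min_def
    by (intro computable_rec_nat computable_basic computable_sum computable_u_emitted) auto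
  moreover have "eventually (\<lambda>t. ?h [t, e] = of_bool (e \<in> diag m)) sequentially" for e
  proof -
    obtain N where N: "eventually (\<lambda>t. diag_count m e t = N) sequentially"
      using diag_count_eventually by blast
    then have "e \<in> diag m \<longleftrightarrow> even N"
      by (rule diag_iff)
    then show ?thesis
      unfolding h by (intro eventually_mono[OF N]) simp
  qed
  ultimately show "limit_computes ?h (diag m)"
    unfolding limit_computes_def h by simp
qed

text \<open>The parity machine for \<open>diag m\<close>, run on its own code \<open>e\<close>,
  would send an odd number of signals iff \<open>e \<in> diag m\<close>, that is, iff it sends an
  even number. The cap does not interfere, because this machine sends at most \<open>m\<close>
  signals for changes and one for the initial value.\<close>

lemma diag_not_signal_class: "diag m \<notin> signal_class timelike \<gamma>1 \<gamma>2 T (enat m)"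
proof
  assume "diag m \<in> signal_class timelike \<gamma>1 \<gamma>2 T (enat m)"
  then obtain h where h: "limit_computes h (diag m)"
    "\<And>n. finite {t. h [Suc t, n] \<noteq> h [t, n]}" "\<And>n. card {t. h [Suc t, n] \<noteq> h [t, n]} \<le> m"
    by (rule signal_class_limit) auto
  obtain P where P: "wf_tm P" and fin: "\<And>n. finite (emission_times P n)"
    and odd: "\<And>n. odd (card (emission_times P n)) \<longleftrightarrow> n \<in> diag m"
    and changes: "\<And>n. finite {t. h [Suc t, n] \<noteq> h [t, n]} \<Longrightarrow>
      card (emission_times P n) \<le> Suc (card {t. h [Suc t, n] \<noteq> h [t, n]})"
    by (rule parity_tm[OF h(1)]) blast
  have card: "card (emission_times P n) \<le> Suc m" for n
    using changes[OF h(2)] h(3)[of n] by (meson Suc_le_mono order_trans)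
  obtain e where e: "tm_code P e"
    using ex_tm_code by blast
  obtain T where T: "emission_times P e \<subseteq> {..<T}"
    using fin finite_nat_iff_bounded by blast
  have "diag_count m e t = card (emission_times P e)" if "t \<ge> T" for t
  proof -
    have "(\<Sum>u<t. if u_emitted e e u = 0 then 0 else 1) = (\<Sum>u<t. if emitted_at P e u = None then 0 else 1 :: nat)"
      unfolding u_emitted_eq[OF P e] by (intro sum.cong) (auto split: option.split elim: code_option.elims)
    also have "\<dots> = card {u \<in> {..<t}. emitted_at P e u \<noteq> None}"
      by (simp add: sum.If_cases Int_def)
    also have "{u \<in> {..<t}. emitted_at P e u \<noteq> None} = emission_times P e"
      using T that by (auto simp: emission_times_def)
    finally show ?thesis
      using card[of e] by (simp add: diag_count_def)
  qed
  then have "eventually (\<lambda>t. diag_count m e t = card (emission_times P e)) sequentially"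
    by (auto simp: eventually_sequentially)
  then have "e \<in> diag m \<longleftrightarrow> even (card (emission_times P e))"
    by (rule diag_iff)
  with odd show False by blast
qed

theorem theoremB:
  fixes timelike :: "('e :: t2_space) timelike_curves"
    and \<gamma>1 \<gamma>2 :: "real \<Rightarrow> 'e" and T :: real and p :: 'e and b :: enat
  assumes "malament_hogarth timelike \<gamma>1 \<gamma>2 T p"
  shows "signal_class timelike \<gamma>1 \<gamma>2 T b \<subseteq> Delta2 \<and>
    (signal_class timelike \<gamma>1 \<gamma>2 T b \<subset> Delta2 \<longleftrightarrow> b < \<infinity>)"
proof (cases b)
  case (enat m)
  have "signal_class timelike \<gamma>1 \<gamma>2 T b \<subset> Delta2"
    using signal_class_Delta2[of timelike \<gamma>1 \<gamma>2 T b] diag_Delta2[of m]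
      diag_not_signal_class[of m timelike \<gamma>1 \<gamma>2 T] unfolding enat by blast
  with enat show ?thesis by auto
next
  case infinity
  have "signal_class timelike \<gamma>1 \<gamma>2 T b = Delta2"
    unfolding infinity
    using signal_class_Delta2[of timelike \<gamma>1 \<gamma>2 T \<infinity>] Delta2_signal_class[OF assms] by blast
  with infinity show ?thesis by auto
qed

end
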